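(* Let $f\in C^2(\mathbb R^2)$ be an entire solution of \[ 2(x-2f_y)(y+2f_x)(f_{yy}-f_{xx})+(1-2f_{xy})(y+2f_x)^2+(x-2f_y)^2(1+2f_{xy})=0 . \] Then there are constants $c_1,c_2$ with $(c_1,c_2)\ne(0,0)$ and a function $F:\mathbb R\to\mathbb R$ such that, in a neighborhood of any regular point, \[ f(x,y)=\begin{cases}\dfrac{c_1x^2}{2c_2}-\dfrac12xy+F(c_1x-c_2y) & \text{if } c_2\ne0,\\[2mm] \dfrac12xy+F(x) & \text{if } c_2=0.\end{cases} \]
   Context: This equation characterizes graphs $z=f(x,y)$ in the Heisenberg group (distribution spanned by $\partial_x-\frac12y\partial_z$ and $\partial_y+\frac12x\partial_z$) with vanishing curvature of transversality. A point $(x,y)$ is regular if $(x-2f_y,\,y+2f_x)\ne(0,0)$. "Entire" means $f$ is defined and $C^2$ on all of $\mathbb R^2$. *)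

theory Defs
  imports "HOL-Analysis.Analysis"
begin

definition px :: "(real \<times> real \<Rightarrow> real) \<Rightarrow> real \<times> real \<Rightarrow> real" where
  "px g = (\<lambda>(x, y). deriv (\<lambda>t. g (t, y)) x)"

definition py :: "(real \<times> real \<Rightarrow> real) \<Rightarrow> real \<times> real \<Rightarrow> real" where
  "py g = (\<lambda>(x, y). deriv (\<lambda>t. g (x, t)) y)"

definition has_partials :: "(real \<times> real \<Rightarrow> real) \<Rightarrow> bool" where
  "has_partials g \<longleftrightarrow>
     (\<forall>x y. (\<lambda>t. g (t, y)) differentiable (at x) \<and> (\<lambda>t. g (x, t)) differentiable (at y))"

definition C2_entire :: "(real \<times> real \<Rightarrow> real) \<Rightarrow> bool" where
  "C2_entire g \<longleftrightarrow>
     has_partials g \<and> has_partials (px g) \<and> has_partials (py g) \<and>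
     continuous_on UNIV g \<and> continuous_on UNIV (px g) \<and> continuous_on UNIV (py g) \<and>
     continuous_on UNIV (px (px g)) \<and> continuous_on UNIV (py (px g)) \<and>
     continuous_on UNIV (px (py g)) \<and> continuous_on UNIV (py (py g))"

definition regular_point :: "(real \<times> real \<Rightarrow> real) \<Rightarrow> real \<times> real \<Rightarrow> bool" where
  "regular_point g p \<longleftrightarrow>
     (fst p - 2 * py g p, snd p + 2 * px g p) \<noteq> (0, 0)"

end

theory Submission
  imports Defs
begin

text \<open>Put u = x - 2 f_y and v = y + 2 f_x. Then u_x + v_y = 2, and the equation says that wherever
  (u, v) is nonzero its direction is constant along the straight line perpendicular to it: the slope
  m = v / u solves Burgers' equation m_y = m m_x. At a singular point u_x or v_y is positive, say u_x.
  Then nearby u = 0 forces v = 0, so the singular set is a Lipschitz graph x = e(y), across which m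
  extends continuously. Continuity makes m a weak solution across the graph, so that m = \<psi>_x for a
  C1 solution of the Hamilton-Jacobi equation \<psi>_y = \<psi>_x^2 / 2, and such m are constant along
  straight characteristics. Hence every characteristic extends to a full line, also through singular
  points; two lines of different direction would meet in a point with two characteristic directions.
  So the direction of (u, v) is globally constant, and c1 u = c2 v is integrated explicitly.\<close>

section \<open>Partial derivatives\<close>

text \<open>The number 2 comes from \<open>1 - 2 f_xy\<close> and \<open>1 + 2 f_xy\<close>, so it
  rests on symmetry of the mixed partials; it is what keeps the differential of (u, v) from
  vanishing anywhere. The obstacle is low regularity: f is only C2, so m is C1 off the singular set,
  but m_x involves a division by u^2 and no bound on it near the graph is at hand. The remedy is to
  use only continuity of m and the closedness of the form m dx + m^2/2 dy, tested on rectangles. A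
  minimisation argument then produces a characteristic segment through each point without solving an
  ODE. A second difficulty is that a line may pass through charts of both kinds (u_x > 0 and v_y >
  0). Continuation along lines is therefore formulated with a homogeneous condition on a direction w
  that favours neither coordinate and makes sense at singular points, where it reads the direction
  off the differential of (u, v).\<close>

lemma has_derivative_of_continuous_partials:
  fixes g gx gy :: "real \<times> real \<Rightarrow> real"
  assumes S: "open S" "(x, y) \<in> S"
    and gx: "\<And>x y. (x, y) \<in> S \<Longrightarrow> ((\<lambda>t. g (t, y)) has_real_derivative gx (x, y)) (at x)"
    and gy: "\<And>x y. (x, y) \<in> S \<Longrightarrow> ((\<lambda>t. g (x, t)) has_real_derivative gy (x, y)) (at y)"
    and cont: "continuous_on S gy"
  shows "(g has_derivative (\<lambda>h. gx (x, y) * fst h + gy (x, y) * snd h)) (at (x, y))"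
proof -
  obtain X Y0 where XY0: "open X" "open Y0" "x \<in> X" "y \<in> Y0" "X \<times> Y0 \<subseteq> S"
    using S by (metis open_prod_elim mem_Sigma_iff)
  then obtain e where e: "e > 0" "ball y e \<subseteq> Y0"
    using openE by blast
  define Y where "Y = ball y e"
  have Y: "open Y" "convex Y" "y \<in> Y" and XY: "X \<times> Y \<subseteq> S"
    using e XY0 by (auto simp: Y_def)
  have "((\<lambda>(x, y). g (x, y)) has_derivative
      (\<lambda>(h, k). gx (x, y) * h + blinfun_mult_right (gy (x, y)) k)) (at (x, y) within X \<times> Y)"
  proof (rule has_derivative_partialsI)
    show "((\<lambda>t. g (t, y)) has_derivative (*) (gx (x, y))) (at x within X)"
      using gx[of x y] S(2) by (simp add: has_field_derivative_def has_derivative_at_withinI)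
    show "((\<lambda>t. g (s, t)) has_derivative blinfun_apply (blinfun_mult_right (gy (s, t)))) (at t within Y)"
      if "s \<in> X" "t \<in> Y" for s t
    proof -
      have "blinfun_apply (blinfun_mult_right (gy (s, t))) = (*) (gy (s, t))"
        by auto
      with gy[of s t] that XY show ?thesis
        by (auto simp: has_field_derivative_def intro: has_derivative_at_withinI)
    qed
    have "continuous_on (X \<times> Y) (\<lambda>q. blinfun_mult_right (gy q))"
      by (intro continuous_intros continuous_on_subset[OF cont XY])
    then show "continuous (at (x, y) within X \<times> Y) (\<lambda>(s, t). blinfun_mult_right (gy (s, t)))"
      using XY0(3) Y(3) by (auto simp: continuous_on_eq_continuous_within split_beta')
  qed (use Y in auto)
  moreover have "open (X \<times> Y)" "(x, y) \<in> X \<times> Y"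
    using XY0 Y by (auto intro: open_Times)
  ultimately show ?thesis
    by (simp add: at_within_open[of "(x, y)" "X \<times> Y"] split_beta')
qed

text \<open>This form of Schwarz's theorem also yields the existence of the second mixed derivative:
  write g as an x-integral of \<open>gx\<close>, differentiate under the integral in y, and then
  differentiate the resulting formula for \<open>gy\<close> in its upper limit.\<close>

lemma mixed_partials_eq:
  fixes g gx gy gxy :: "real \<times> real \<Rightarrow> real"
  assumes gx: "\<And>x y. ((\<lambda>t. g (t, y)) has_real_derivative gx (x, y)) (at x)"
    and gy: "\<And>x y. ((\<lambda>t. g (x, t)) has_real_derivative gy (x, y)) (at y)"
    and gxy: "\<And>x y. ((\<lambda>t. gx (x, t)) has_real_derivative gxy (x, y)) (at y)"
    and cont: "continuous_on UNIV gx" "continuous_on UNIV gxy"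
  shows "((\<lambda>t. gy (t, y)) has_real_derivative gxy (x, y)) (at x)"
proof -
  have cx: "continuous_on A (\<lambda>t. gx (t, z))" and cxy: "continuous_on A (\<lambda>t. gxy (t, z))" for A z
    by (intro continuous_on_compose2[OF cont(1)] continuous_on_compose2[OF cont(2)] continuous_intros; simp)+
  have *: "gy (s, y) = gy (x - 1, y) + integral {x - 1..s} (\<lambda>t. gxy (t, y))" if "x - 1 \<le> s" for s
  proof -
    have g: "g (s, z) = g (x - 1, z) + integral {x - 1..s} (\<lambda>t. gx (t, z))" for z
    proof -
      have "((\<lambda>t. gx (t, z)) has_integral g (s, z) - g (x - 1, z)) {x - 1..s}"
        using that gx[of z]
        by (intro fundamental_theorem_of_calculus)
          (auto simp: has_real_derivative_iff_has_vector_derivative intro: has_vector_derivative_at_within)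
      then show ?thesis
        by (simp add: integral_unique)
    qed
    have "((\<lambda>z. integral (cbox (x - 1) s) (\<lambda>t. gx (t, z))) has_field_derivative
        integral (cbox (x - 1) s) (\<lambda>t. gxy (t, y))) (at y within UNIV)"
    proof (rule leibniz_rule_field_derivative)
      show "continuous_on (UNIV \<times> cbox (x - 1) s) (\<lambda>(z, t). gxy (t, z))"
        unfolding split_beta by (intro continuous_on_compose2[OF cont(2)] continuous_intros; simp)
    qed (use gxy cx in \<open>auto intro!: integrable_continuous_real\<close>)
    then have "((\<lambda>z. g (x - 1, z) + integral {x - 1..s} (\<lambda>t. gx (t, z))) has_real_derivative
        gy (x - 1, y) + integral {x - 1..s} (\<lambda>t. gxy (t, y))) (at y)"
      by (intro DERIV_add gy) auto
    then have "((\<lambda>z. g (s, z)) has_real_derivative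
        gy (x - 1, y) + integral {x - 1..s} (\<lambda>t. gxy (t, y))) (at y)"
      by (simp add: g[symmetric])
    with gy show ?thesis
      by (rule DERIV_unique)
  qed
  \<comment> \<open>The base point \<open>x - 1\<close> serves only to make x interior to the
    interval, so that the one-sided fundamental theorem gives a full derivative.\<close>
  have "((\<lambda>s. integral {x - 1..s} (\<lambda>t. gxy (t, y))) has_real_derivative gxy (x, y)) (at x within {x - 1..x + 1})"
    using integral_has_real_derivative[OF cxy, where t=x] by simp
  moreover have "at x within {x - 1..x + 1} = at x"
    by (rule at_within_interior) simp
  ultimately have "((\<lambda>s. gy (x - 1, y) + integral {x - 1..s} (\<lambda>t. gxy (t, y))) has_real_derivative 0 + gxy (x, y)) (at x)"
    by (intro DERIV_add DERIV_const) simp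
  then show ?thesis
    unfolding add_0_left
  proof (rule has_field_derivative_transform_within_open[where S="{x - 1<..}"])
    show "gy (x - 1, y) + integral {x - 1..s} (\<lambda>t. gxy (t, y)) = gy (s, y)" if "s \<in> {x - 1<..}" for s
      using *[of s] that by simp
  qed auto
qed

section \<open>Potentials of continuous solutions of Burgers' equation\<close>

text \<open>The clockwise circulation of the form m dx + m^2/2 dy around the boundary of the
  rectangle from (a, c) to (b, d). Its vanishing on all rectangles is the integral form of m_y =
  (m^2/2)_x and involves no derivative of m.\<close>

definition flux_defect :: "(real \<times> real \<Rightarrow> real) \<Rightarrow> real \<Rightarrow> real \<Rightarrow> real \<Rightarrow> real \<Rightarrow> real" where
  "flux_defect m a b c d = integral {a..b} (\<lambda>x. m (x, d)) - integral {a..b} (\<lambda>x. m (x, c))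
     - integral {c..d} (\<lambda>y. ((m (b, y))\<^sup>2 - (m (a, y))\<^sup>2) / 2)"

lemma continuous_on_slices:
  fixes m :: "real \<times> real \<Rightarrow> real"
  assumes "continuous_on ({a..b} \<times> {c..d}) m"
  shows "y \<in> {c..d} \<Longrightarrow> a \<le> a' \<Longrightarrow> b' \<le> b \<Longrightarrow> continuous_on {a'..b'} (\<lambda>x. m (x, y))"
    and "x \<in> {a..b} \<Longrightarrow> c \<le> c' \<Longrightarrow> d' \<le> d \<Longrightarrow> continuous_on {c'..d'} (\<lambda>y. m (x, y))"
  by (auto intro!: continuous_on_compose2[OF assms] continuous_intros)

lemma flux_defect_split_x:
  assumes m: "continuous_on ({a..b} \<times> {c..d}) m" and "a \<le> s" "s \<le> b" "c \<le> d"
  shows "flux_defect m a b c d = flux_defect m a s c d + flux_defect m s b c d"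
proof -
  note sl = continuous_on_slices[OF m]
  have i: "integral {a..s} (\<lambda>x. m (x, y)) + integral {s..b} (\<lambda>x. m (x, y)) = integral {a..b} (\<lambda>x. m (x, y))"
    if "y \<in> {c..d}" for y
    using that assms by (intro Henstock_Kurzweil_Integration.integral_combine integrable_continuous_real sl) auto
  have "integral {c..d} (\<lambda>y. ((m (b, y))\<^sup>2 - (m (a, y))\<^sup>2) / 2) =
      integral {c..d} (\<lambda>y. ((m (s, y))\<^sup>2 - (m (a, y))\<^sup>2) / 2 + ((m (b, y))\<^sup>2 - (m (s, y))\<^sup>2) / 2)"
    by (intro integral_cong) (simp add: field_simps)
  also have "\<dots> = integral {c..d} (\<lambda>y. ((m (s, y))\<^sup>2 - (m (a, y))\<^sup>2) / 2) +
      integral {c..d} (\<lambda>y. ((m (b, y))\<^sup>2 - (m (s, y))\<^sup>2) / 2)"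
    using assms by (intro integral_add integrable_continuous_real continuous_intros sl) auto
  finally show ?thesis
    using i[of c] i[of d] assms unfolding flux_defect_def by (simp del: integral_divide)
qed

lemma flux_defect_split_y:
  assumes m: "continuous_on ({a..b} \<times> {c..d}) m" and "a \<le> b" "c \<le> s" "s \<le> d"
  shows "flux_defect m a b c d = flux_defect m a b c s + flux_defect m a b s d"
proof -
  note sl = continuous_on_slices[OF m]
  have "integral {c..s} (\<lambda>y. ((m (b, y))\<^sup>2 - (m (a, y))\<^sup>2) / 2) +
      integral {s..d} (\<lambda>y. ((m (b, y))\<^sup>2 - (m (a, y))\<^sup>2) / 2) =
      integral {c..d} (\<lambda>y. ((m (b, y))\<^sup>2 - (m (a, y))\<^sup>2) / 2)"
    using assms
    by (intro Henstock_Kurzweil_Integration.integral_combine integrable_continuous_real continuous_intros sl) auto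
  then show ?thesis
    by (simp add: flux_defect_def)
qed

text \<open>Pairs opposite edges: both differences are controlled by the oscillation, the one of
  squares after factoring out the mean value. It serves for the small boxes on which
  differentiability is unknown.\<close>

lemma flux_defect_bound:
  assumes m: "continuous_on ({a..b} \<times> {c..d}) m" and ab: "a \<le> b" "c \<le> d"
    and M: "\<And>p. p \<in> {a..b} \<times> {c..d} \<Longrightarrow> \<bar>m p\<bar> \<le> M"
    and osc: "\<And>p q. p \<in> {a..b} \<times> {c..d} \<Longrightarrow> q \<in> {a..b} \<times> {c..d} \<Longrightarrow> \<bar>m p - m q\<bar> \<le> \<epsilon>"
  shows "\<bar>flux_defect m a b c d\<bar> \<le> \<epsilon> * (b - a) + M * \<epsilon> * (d - c)"
proof -
  note sl = continuous_on_slices[OF m]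
  have "norm (integral {a..b} (\<lambda>x. m (x, d) - m (x, c))) \<le> \<epsilon> * (b - a)"
    using ab osc by (intro integral_bound continuous_intros sl) auto
  also have "integral {a..b} (\<lambda>x. m (x, d) - m (x, c)) =
      integral {a..b} (\<lambda>x. m (x, d)) - integral {a..b} (\<lambda>x. m (x, c))"
    using ab by (intro integral_diff integrable_continuous_real sl) auto
  finally have 1: "\<bar>integral {a..b} (\<lambda>x. m (x, d)) - integral {a..b} (\<lambda>x. m (x, c))\<bar> \<le> \<epsilon> * (b - a)"
    by simp
  have "norm (integral {c..d} (\<lambda>y. ((m (b, y))\<^sup>2 - (m (a, y))\<^sup>2) / 2)) \<le> (M * \<epsilon>) * (d - c)"
  proof (intro integral_bound continuous_intros sl)
    fix y assume y: "y \<in> {c..d}"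
    have "((m (b, y))\<^sup>2 - (m (a, y))\<^sup>2) / 2 = (m (b, y) + m (a, y)) / 2 * (m (b, y) - m (a, y))"
      by (simp add: power2_eq_square field_simps)
    moreover have "\<bar>(m (b, y) + m (a, y)) / 2\<bar> \<le> M"
      using M[of "(b, y)"] M[of "(a, y)"] y ab by (simp add: abs_le_iff)
    moreover have "\<bar>m (b, y) - m (a, y)\<bar> \<le> \<epsilon>"
      using osc y ab by auto
    ultimately show "norm (((m (b, y))\<^sup>2 - (m (a, y))\<^sup>2) / 2) \<le> M * \<epsilon>"
      unfolding real_norm_def by (simp only: abs_mult mult_mono' abs_ge_zero)
  qed (use ab in auto)
  with 1 show ?thesis
    unfolding flux_defect_def by (simp add: abs_if split: if_splits)
qed

text \<open>Differentiating the horizontal integral of m in y gives the integral of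
  \<open>m * mx\<close>, which is the increment of m^2/2 between the vertical edges; integrating in
  y closes the circulation.\<close>

lemma flux_defect_zero_smooth:
  fixes m mx :: "real \<times> real \<Rightarrow> real"
  assumes ab: "a \<le> b" "c \<le> d"
    and dx: "\<And>x y. x \<in> {a..b} \<Longrightarrow> y \<in> {c..d} \<Longrightarrow> ((\<lambda>t. m (t, y)) has_real_derivative mx (x, y)) (at x)"
    and dy: "\<And>x y. x \<in> {a..b} \<Longrightarrow> y \<in> {c..d} \<Longrightarrow>
      ((\<lambda>t. m (x, t)) has_real_derivative m (x, y) * mx (x, y)) (at y)"
    and m: "continuous_on ({a..b} \<times> {c..d}) m" and mx: "continuous_on ({a..b} \<times> {c..d}) mx"
  shows "flux_defect m a b c d = 0"
proof -
  note sl = continuous_on_slices[OF m]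
  have "((\<lambda>y. ((m (b, y))\<^sup>2 - (m (a, y))\<^sup>2) / 2) has_integral
     integral {a..b} (\<lambda>x. m (x, d)) - integral {a..b} (\<lambda>x. m (x, c))) {c..d}"
  proof (rule fundamental_theorem_of_calculus[OF ab(2)])
    fix y assume y: "y \<in> {c..d}"
    have "((\<lambda>y. integral (cbox a b) (\<lambda>x. m (x, y))) has_field_derivative
        integral (cbox a b) (\<lambda>x. m (x, y) * mx (x, y))) (at y within {c..d})"
    proof (rule leibniz_rule_field_derivative)
      show "continuous_on ({c..d} \<times> cbox a b) (\<lambda>(y, x). m (x, y) * mx (x, y))"
        unfolding split_beta
        by (intro continuous_intros continuous_on_compose2[OF m] continuous_on_compose2[OF mx]) auto
    qed (use dy y sl in \<open>auto intro!: integrable_continuous_real intro: has_field_derivative_at_within\<close>)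
    moreover have "((\<lambda>x. m (x, y) * mx (x, y)) has_integral (m (b, y))\<^sup>2 / 2 - (m (a, y))\<^sup>2 / 2) {a..b}"
      using dx y
      by (intro fundamental_theorem_of_calculus[OF ab(1)])
        (auto simp: has_real_derivative_iff_has_vector_derivative[symmetric]
          intro!: derivative_eq_intros intro: has_field_derivative_at_within)
    ultimately show "((\<lambda>y. integral {a..b} (\<lambda>x. m (x, y))) has_vector_derivative
        ((m (b, y))\<^sup>2 - (m (a, y))\<^sup>2) / 2) (at y within {c..d})"
      by (simp add: has_real_derivative_iff_has_vector_derivative integral_unique diff_divide_distrib)
  qed
  then show ?thesis
    by (simp only: flux_defect_def integral_unique)
qed

lemma flux_defect_degenerate [simp]: "flux_defect m a a c d = 0"
  by (simp add: flux_defect_def)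

section \<open>Continuous solutions of Burgers' equation that are smooth off a Lipschitz
  graph\<close>

text \<open>The values of \<open>e\<close> are not confined to \<open>{a..b}\<close>: a graph
  running outside the box covers the case without singular points, so that both cases share one
  interface.\<close>

locale burgers_off_graph =
  fixes m mx :: "real \<times> real \<Rightarrow> real" and e :: "real \<Rightarrow> real" and L a b c d :: real
  assumes lt: "a < b" "c < d"
    and L: "L \<ge> 0"
    and lipschitz: "\<And>y z. y \<in> {c..d} \<Longrightarrow> z \<in> {c..d} \<Longrightarrow> \<bar>e y - e z\<bar> \<le> L * \<bar>y - z\<bar>"
    and cont: "continuous_on ({a..b} \<times> {c..d}) m"
    and contx: "continuous_on {p \<in> {a..b} \<times> {c..d}. fst p \<noteq> e (snd p)} mx"
    and dx: "\<And>x y. x \<in> {a..b} \<Longrightarrow> y \<in> {c..d} \<Longrightarrow> x \<noteq> e y \<Longrightarrow>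
      ((\<lambda>t. m (t, y)) has_real_derivative mx (x, y)) (at x)"
    and dy: "\<And>x y. x \<in> {a..b} \<Longrightarrow> y \<in> {c..d} \<Longrightarrow> x \<noteq> e y \<Longrightarrow>
      ((\<lambda>t. m (x, t)) has_real_derivative m (x, y) * mx (x, y)) (at y)"
begin

lemma defect_off_graph:
  assumes "a \<le> a'" "a' \<le> b'" "b' \<le> b" "c \<le> s" "s \<le> t" "t \<le> d"
    and off: "\<And>x y. x \<in> {a'..b'} \<Longrightarrow> y \<in> {s..t} \<Longrightarrow> x \<noteq> e y"
  shows "flux_defect m a' b' s t = 0"
proof (rule flux_defect_zero_smooth)
  show "continuous_on ({a'..b'} \<times> {s..t}) m"
    using assms by (intro continuous_on_subset[OF cont]) auto
  show "continuous_on ({a'..b'} \<times> {s..t}) mx"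
    using assms by (intro continuous_on_subset[OF contx]) auto
qed (use assms dx dy in auto)

text \<open>A strip of height h splits into two side boxes that miss the graph, where the defect
  vanishes, and a middle box of width at most 2Kh around it, where uniform continuity makes the
  oscillation small.\<close>

lemma defect_small:
  assumes "\<epsilon> > 0" and ab': "a \<le> a'" "a' \<le> b'" "b' \<le> b"
  shows "\<exists>\<delta>>0. \<forall>s t. c \<le> s \<longrightarrow> s < t \<longrightarrow> t \<le> d \<longrightarrow> t - s < \<delta> \<longrightarrow>
    \<bar>flux_defect m a' b' s t\<bar> \<le> \<epsilon> * (t - s)"
proof -
  define R where "R = {a..b} \<times> {c..d}"
  have "compact R"
    unfolding R_def by (intro compact_Times) auto
  then have "bounded (m ` R)"
    using cont by (auto simp: R_def intro: compact_imp_bounded compact_continuous_image)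
  then obtain M where M: "M > 0" "\<And>p. p \<in> R \<Longrightarrow> \<bar>m p\<bar> \<le> M"
    by (auto simp: bounded_pos)
  \<comment> \<open>Exceeding \<open>L\<close> makes the graph stay strictly inside the middle box,
    so that the closed side boxes do not touch it.\<close>
  define K where "K = L + 1"
  have "K > 0"
    using L by (simp add: K_def)
  \<comment> \<open>Chosen so that the bound for a box of width \<open>2 * K * h\<close> and height
    h, namely \<open>\<epsilon>' * (2 * K * h) + M * \<epsilon>' * h\<close>, is exactly
    \<open>\<epsilon> * h\<close>.\<close>
  define \<epsilon>' where "\<epsilon>' = \<epsilon> / (2 * K + M)"
  have \<epsilon>': "\<epsilon>' > 0" "\<epsilon>' * (2 * K + M) = \<epsilon>"
    using \<open>\<epsilon> > 0\<close> \<open>K > 0\<close> \<open>M > 0\<close> by (auto simp: \<epsilon>'_def)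
  have "uniformly_continuous_on R m"
    using cont \<open>compact R\<close> by (simp add: R_def compact_uniformly_continuous)
  then obtain \<delta>' where \<delta>': "\<delta>' > 0" "\<And>p q. p \<in> R \<Longrightarrow> q \<in> R \<Longrightarrow> dist q p < \<delta>' \<Longrightarrow> dist (m q) (m p) < \<epsilon>'"
    unfolding uniformly_continuous_on_def using \<epsilon>'(1) by metis
  \<comment> \<open>Width plus height of the middle box is at most \<open>(2 * K + 1) * h\<close>,
    which bounds its diameter.\<close>
  define \<delta> where "\<delta> = \<delta>' / (2 * K + 1)"
  have \<delta>: "\<delta> > 0" "\<delta> * (2 * K + 1) = \<delta>'"
    using \<open>K > 0\<close> \<open>\<delta>' > 0\<close> by (auto simp: \<delta>_def)
  have "\<bar>flux_defect m a' b' s t\<bar> \<le> \<epsilon> * (t - s)"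
    if st: "c \<le> s" "s < t" "t \<le> d" "t - s < \<delta>" for s t
  proof -
    define h where "h = t - s"
    have h: "h > 0" "h < \<delta>"
      using st by (auto simp: h_def)
    have "K * h > 0"
      using h \<open>K > 0\<close> by simp
    \<comment> \<open>Clamping to \<open>{a'..b'}\<close> lets one argument treat a graph that
      crosses the strip, leaves it or misses it; a side box may then degenerate to a
      segment.\<close>
    define l where "l = max a' (min b' (e s - K * h))"
    define r where "r = max a' (min b' (e s + K * h))"
    have lr: "a' \<le> l" "l \<le> r" "r \<le> b'"
      using ab' \<open>K * h > 0\<close> by (auto simp: l_def r_def)
    have e: "\<bar>e y - e s\<bar> < K * h" if "y \<in> {s..t}" for y
    proof -
      have "\<bar>e y - e s\<bar> \<le> L * \<bar>y - s\<bar>"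
        using lipschitz[of y s] that st by auto
      also have "\<dots> \<le> L * h"
        using that L by (intro mult_left_mono) (auto simp: h_def)
      also have "\<dots> < K * h"
        using h by (simp add: K_def)
      finally show ?thesis .
    qed
    have "flux_defect m a' l s t = 0"
    proof (cases "a' = l")
      case False
      then have "l \<le> e s - K * h"
        by (auto simp: l_def max_def min_def split: if_splits)
      then show ?thesis
        using e lr ab' st by (intro defect_off_graph) fastforce+
    qed simp
    moreover have "flux_defect m r b' s t = 0"
    proof (cases "b' = r")
      case False
      then have "r \<ge> e s + K * h"
        using ab' by (auto simp: r_def max_def min_def split: if_splits)
      then show ?thesis
        using e lr ab' st by (intro defect_off_graph) fastforce+
    qed simp
    moreover have "\<bar>flux_defect m l r s t\<bar> \<le> \<epsilon>' * (r - l) + M * \<epsilon>' * (t - s)"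
    proof (rule flux_defect_bound)
      have sub: "{l..r} \<times> {s..t} \<subseteq> R"
        using lr ab' st by (auto simp: R_def)
      then show "continuous_on ({l..r} \<times> {s..t}) m"
        using cont unfolding R_def by (rule continuous_on_subset[rotated])
      show "\<bar>m p\<bar> \<le> M" if "p \<in> {l..r} \<times> {s..t}" for p
        using M sub that by blast
      have rl: "r - l \<le> 2 * K * h"
        using ab' \<open>K * h > 0\<close> by (auto simp: l_def r_def max_def min_def)
      show "\<bar>m p - m q\<bar> \<le> \<epsilon>'" if pq: "p \<in> {l..r} \<times> {s..t}" "q \<in> {l..r} \<times> {s..t}" for p q
      proof -
        have "dist p q \<le> dist (fst p) (fst q) + dist (snd p) (snd q)"
          by (simp add: dist_prod_def sqrt_sum_squares_le_sum)
        also have "\<dots> \<le> (r - l) + (t - s)"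
          using pq by (auto simp: dist_real_def)
        also have "\<dots> \<le> h * (2 * K + 1)"
          using rl by (simp add: h_def algebra_simps)
        also have "\<dots> < \<delta>'"
          using h \<open>K > 0\<close> by (simp flip: \<delta>(2))
        finally show ?thesis
          using \<delta>'(2)[of q p] subsetD[OF sub pq(1)] subsetD[OF sub pq(2)] by (simp add: dist_real_def)
      qed
    qed (use lr st in auto)
    moreover have "\<epsilon>' * (r - l) + M * \<epsilon>' * (t - s) \<le> \<epsilon> * (t - s)"
    proof -
      have "r - l \<le> 2 * K * (t - s)"
        using ab' \<open>K * h > 0\<close> by (auto simp: l_def r_def max_def min_def h_def)
      then have "\<epsilon>' * (r - l) \<le> \<epsilon>' * (2 * K * (t - s))"
        using \<epsilon>'(1) by (intro mult_left_mono) auto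
      then show ?thesis
        by (simp add: algebra_simps flip: \<epsilon>'(2))
    qed
    moreover have "flux_defect m a' b' s t =
        flux_defect m a' l s t + (flux_defect m l r s t + flux_defect m r b' s t)"
    proof -
      have c: "continuous_on ({a'..b'} \<times> {s..t}) m" "continuous_on ({l..b'} \<times> {s..t}) m"
        using lr ab' st by (auto intro!: continuous_on_subset[OF cont])
      show ?thesis
        using lr st by (simp add: flux_defect_split_x[OF c(1), of l] flux_defect_split_x[OF c(2), of r])
    qed
    ultimately show ?thesis
      by linarith
  qed
  with \<delta>(1) show ?thesis
    by blast
qed

text \<open>The graph is crossed by the rectangles of height h only in a piece of width O(h) on which
  \<^term>\<open>m\<close> oscillates by o(1); hence the defect is a function of the upper edge with derivative 0.\<close>

lemma defect_zero:
  assumes "a \<le> a'" "a' \<le> b'" "b' \<le> b" "t \<in> {c..d}"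
  shows "flux_defect m a' b' c t = 0"
proof -
  define D where "D = flux_defect m a' b' c"
  have split: "D z = D y + flux_defect m a' b' y z" if "c \<le> y" "y \<le> z" "z \<le> d" for y z
    unfolding D_def using assms that
    by (intro flux_defect_split_y continuous_on_subset[OF cont]) auto
  have "(D has_field_derivative 0) (at y within {c..d})" if y: "y \<in> {c..d}" for y
    unfolding has_field_derivative_def has_derivative_within_alt
  proof (intro conjI allI impI)
    fix \<epsilon> :: real assume "\<epsilon> > 0"
    then obtain \<delta> where \<delta>: "\<delta> > 0" "\<And>s t. c \<le> s \<Longrightarrow> s < t \<Longrightarrow> t \<le> d \<Longrightarrow> t - s < \<delta> \<Longrightarrow>
        \<bar>flux_defect m a' b' s t\<bar> \<le> \<epsilon> * (t - s)"
      using defect_small assms by metis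
    have "norm (D z - D y - 0 * (z - y)) \<le> \<epsilon> * norm (z - y)"
      if z: "z \<in> {c..d}" "norm (z - y) < \<delta>" for z
    proof -
      consider "z = y" | "y < z" | "z < y"
        by linarith
      then show ?thesis
      proof cases
        case 2
        with \<delta>(2)[of y z] split[of y z] y z show ?thesis
          by simp
      next
        case 3
        with \<delta>(2)[of z y] split[of z y] y z show ?thesis
          by simp
      qed simp
    qed
    with \<delta>(1) show "\<exists>d'>0. \<forall>z\<in>{c..d}. norm (z - y) < d' \<longrightarrow>
        norm (D z - D y - 0 * (z - y)) \<le> \<epsilon> * norm (z - y)"
      by blast
  qed (simp add: bounded_linear_mult_right)
  then obtain k where k: "\<And>y. y \<in> {c..d} \<Longrightarrow> D y = k"
    using has_field_derivative_zero_constant[of "{c..d}" D] by auto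
  then have "D t = D c"
    using assms(4) by auto
  also have "D c = 0"
    by (simp add: D_def flux_defect_def)
  finally show ?thesis
    by (simp add: D_def)
qed

text \<open>Integrate the closed form from the corner (a, c). Going up the left edge first makes the
  x-derivative visible, going along the bottom edge first the y-derivative;
  \<open>defect_zero\<close> says that the two routes agree. Continuity of the partials upgrades
  them to a full derivative.\<close>

lemma potential:
  obtains \<psi> where "\<And>p. p \<in> {a<..<b} \<times> {c<..<d} \<Longrightarrow>
    (\<psi> has_derivative (\<lambda>h. m p * fst h + (m p)\<^sup>2 / 2 * snd h)) (at p)"
proof -
  note sl = continuous_on_slices[OF cont]
  define \<psi> where "\<psi> p = integral {a..fst p} (\<lambda>x. m (x, snd p))
    + integral {c..snd p} (\<lambda>y. (m (a, y))\<^sup>2 / 2)" for p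
  have alt: "\<psi> (x, y) = integral {a..x} (\<lambda>x. m (x, c)) + integral {c..y} (\<lambda>y. (m (x, y))\<^sup>2 / 2)"
    if "x \<in> {a..b}" "y \<in> {c..d}" for x y
  proof -
    have "integral {c..y} (\<lambda>y. ((m (x, y))\<^sup>2 - (m (a, y))\<^sup>2) / 2) =
      integral {c..y} (\<lambda>y. (m (x, y))\<^sup>2 / 2 - (m (a, y))\<^sup>2 / 2)"
      by (simp only: diff_divide_distrib)
    also have "\<dots> = integral {c..y} (\<lambda>y. (m (x, y))\<^sup>2 / 2) - integral {c..y} (\<lambda>y. (m (a, y))\<^sup>2 / 2)"
      using that lt by (intro integral_diff integrable_continuous_real continuous_intros sl) auto
    finally show ?thesis
      using defect_zero[of a x y] that unfolding flux_defect_def \<psi>_def fst_conv snd_conv by auto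
  qed
  have inner: "at s within {l..u} = at s" if "l < s" "s < u" for s l u :: real
    using that by (intro at_within_interior) auto
  have \<psi>x: "((\<lambda>t. \<psi> (t, y)) has_real_derivative m (x, y)) (at x)"
    if "x \<in> {a<..<b}" "y \<in> {c<..<d}" for x y
  proof -
    have "((\<lambda>t. integral {a..t} (\<lambda>x. m (x, y))) has_real_derivative m (x, y)) (at x within {a..b})"
      using that by (intro integral_has_real_derivative sl) auto
    then show ?thesis
      using that unfolding \<psi>_def by (auto intro!: derivative_eq_intros simp: inner)
  qed
  have \<psi>y: "((\<lambda>t. \<psi> (x, t)) has_real_derivative (m (x, y))\<^sup>2 / 2) (at y)"
    if "x \<in> {a<..<b}" "y \<in> {c<..<d}" for x y
  proof -
    have "((\<lambda>t. integral {c..t} (\<lambda>y. (m (x, y))\<^sup>2 / 2)) has_real_derivative (m (x, y))\<^sup>2 / 2) (at y within {c..d})"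
      using that by (intro integral_has_real_derivative continuous_intros sl) auto
    then have "((\<lambda>t. integral {a..x} (\<lambda>x. m (x, c)) + integral {c..t} (\<lambda>y. (m (x, y))\<^sup>2 / 2)) has_real_derivative
        0 + (m (x, y))\<^sup>2 / 2) (at y)"
      using that by (intro DERIV_add DERIV_const) (simp add: inner)
    then have "((\<lambda>t. integral {a..x} (\<lambda>x. m (x, c)) + integral {c..t} (\<lambda>y. (m (x, y))\<^sup>2 / 2)) has_real_derivative
        (m (x, y))\<^sup>2 / 2) (at y)"
      by (simp only: add_0_left)
    then show ?thesis
      by (rule has_field_derivative_transform_within_open[where S="{c<..<d}"]) (use alt that in auto)
  qed
  have "(\<psi> has_derivative (\<lambda>h. m p * fst h + (m p)\<^sup>2 / 2 * snd h)) (at p)"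
    if "p \<in> {a<..<b} \<times> {c<..<d}" for p
  proof -
    have "(\<psi> has_derivative (\<lambda>h. m (fst p, snd p) * fst h + (m (fst p, snd p))\<^sup>2 / 2 * snd h))
        (at (fst p, snd p))"
    proof (rule has_derivative_of_continuous_partials[where S="{a<..<b} \<times> {c<..<d}" and gy="\<lambda>p. (m p)\<^sup>2 / 2"])
      show "continuous_on ({a<..<b} \<times> {c<..<d}) (\<lambda>p. (m p)\<^sup>2 / 2)"
        by (intro continuous_intros continuous_on_subset[OF cont]) auto
    qed (use that \<psi>x \<psi>y in \<open>auto intro: open_Times\<close>)
    then show ?thesis
      by simp
  qed
  then show thesis
    by (rule that)
qed

end

section \<open>Characteristics of a Hamilton-Jacobi equation\<close>

text \<open>With g \<sigma> h the value of \<psi> plus half \<sigma>^2 h at the end of the segment of slope \<sigma> and height h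
  from the origin, g \<sigma> is nondecreasing for every \<sigma>. By the Hopf-Lax formula the minimum over \<sigma> does
  not depend on h (a minimiser is its own slope there, so prolonging the segment by k raises g only by o(k));
  along the minimising segment g \<sigma> is therefore constant, which forces m = \<sigma>.\<close>

lemma hamilton_jacobi_characteristic:
  fixes \<psi> m :: "real \<times> real \<Rightarrow> real"
  assumes "r > 0"
    and \<psi>: "\<And>p. p \<in> {-r<..<r} \<times> {-r<..<r} \<Longrightarrow>
      (\<psi> has_derivative (\<lambda>h. m p * fst h + (m p)\<^sup>2 / 2 * snd h)) (at p)"
    and m: "continuous_on ({-r<..<r} \<times> {-r<..<r}) m"
  shows "\<exists>H>0. \<forall>t\<in>{0..H}. m (- m (0, 0) * t, t) = m (0, 0)"
proof -
  define B where "B = {-r/2..r/2} \<times> {-r/2..r/2}"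
  have Bsub: "B \<subseteq> {-r<..<r} \<times> {-r<..<r}"
    using \<open>r > 0\<close> by (auto simp: B_def)
  have "compact B"
    unfolding B_def by (intro compact_Times) auto
  then have "bounded (m ` B)"
    by (intro compact_imp_bounded compact_continuous_image continuous_on_subset[OF m Bsub])
  then obtain M0 where M0: "\<And>p. p \<in> B \<Longrightarrow> \<bar>m p\<bar> \<le> M0"
    by (auto simp: bounded_iff)
  \<comment> \<open>The strict bound \<open>\<bar>m p\<bar> < M\<close> will keep minimising slopes
    off the endpoints of \<open>{-M..M}\<close>.\<close>
  define M where "M = \<bar>M0\<bar> + 1"
  have "M \<ge> 1"
    by (simp add: M_def)
  have mM: "\<bar>m p\<bar> < M" if "p \<in> B" for p
    using M0[OF that] by (simp add: M_def)
  \<comment> \<open>At height at most \<open>H\<close>, segments of slope at most \<open>M\<close>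
    in absolute value stay inside \<open>B\<close>.\<close>
  define H where "H = r / (2 * M)"
  have H: "H > 0" "M * H = r / 2" "H \<le> r / 2"
    using \<open>M \<ge> 1\<close> \<open>r > 0\<close> by (auto simp: H_def field_simps)
  have inB: "(- (\<sigma> * h), h) \<in> B" if "\<sigma> \<in> {-M..M}" "h \<in> {0..H}" for \<sigma> h
  proof -
    have "\<bar>\<sigma>\<bar> * \<bar>h\<bar> \<le> M * H"
      using that \<open>M \<ge> 1\<close> by (intro mult_mono) auto
    then have "\<bar>\<sigma> * h\<bar> \<le> r / 2"
      by (simp add: H(2) abs_mult)
    then have "- (\<sigma> * h) \<in> {-r/2..r/2}"
      by auto
    moreover have "h \<in> {-r/2..r/2}"
      using that H(3) \<open>r > 0\<close> by auto
    ultimately show ?thesis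
      by (simp only: B_def mem_Sigma_iff simp_thms)
  qed
  define g where "g \<sigma> h = \<psi> (- (\<sigma> * h), h) + \<sigma>\<^sup>2 * h / 2" for \<sigma> h
  \<comment> \<open>Since the gradient of \<psi> is (m, m^2/2), the derivative is m^2/2 - \<sigma> m
    + \<sigma>^2/2, a perfect square; this is where the Hamilton-Jacobi equation enters.\<close>
  have dh: "((\<lambda>h. g \<sigma> h) has_real_derivative (m (- (\<sigma> * h), h) - \<sigma>)\<^sup>2 / 2) (at h)"
    if "\<sigma> \<in> {-M..M}" "h \<in> {0..H}" for \<sigma> h
  proof -
    have "(- (\<sigma> * h), h) \<in> {-r<..<r} \<times> {-r<..<r}"
      using inB[OF that] Bsub by blast
    note D = \<psi>[OF this]
    have "((\<lambda>h. \<psi> (- (\<sigma> * h), h)) has_derivative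
        (\<lambda>k. m (- (\<sigma> * h), h) * fst (- (\<sigma> * k), k) + (m (- (\<sigma> * h), h))\<^sup>2 / 2 * snd (- (\<sigma> * k), k))) (at h)"
      by (rule has_derivative_compose[where f="\<lambda>h. (- (\<sigma> * h), h)", OF _ D]) (auto intro!: derivative_eq_intros)
    then have "((\<lambda>h. \<psi> (- (\<sigma> * h), h)) has_real_derivative
        (- (\<sigma> * m (- (\<sigma> * h), h)) + (m (- (\<sigma> * h), h))\<^sup>2 / 2)) (at h)"
      unfolding has_field_derivative_def by (rule has_derivative_eq_rhs) (auto simp: algebra_simps)
    then show ?thesis
      unfolding g_def by (auto intro!: derivative_eq_intros simp: power2_eq_square field_simps)
  qed
  have d\<sigma>: "((\<lambda>\<sigma>. g \<sigma> h) has_real_derivative h * (\<sigma> - m (- (\<sigma> * h), h))) (at \<sigma>)"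
    if "\<sigma> \<in> {-M..M}" "h \<in> {0..H}" for \<sigma> h
  proof -
    have "(- (\<sigma> * h), h) \<in> {-r<..<r} \<times> {-r<..<r}"
      using inB[OF that] Bsub by blast
    note D = \<psi>[OF this]
    have "((\<lambda>\<sigma>. \<psi> (- (\<sigma> * h), h)) has_derivative
        (\<lambda>k. m (- (\<sigma> * h), h) * fst (- (k * h), 0::real) + (m (- (\<sigma> * h), h))\<^sup>2 / 2 * snd (- (k * h), 0))) (at \<sigma>)"
      by (rule has_derivative_compose[where f="\<lambda>\<sigma>. (- (\<sigma> * h), h)", OF _ D]) (auto intro!: derivative_eq_intros)
    then have "((\<lambda>\<sigma>. \<psi> (- (\<sigma> * h), h)) has_real_derivative
        (- (h * m (- (\<sigma> * h), h)))) (at \<sigma>)"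
      unfolding has_field_derivative_def by (rule has_derivative_eq_rhs) (auto simp: algebra_simps)
    then show ?thesis
      unfolding g_def by (auto intro!: derivative_eq_intros simp: power2_eq_square field_simps)
  qed
  have \<psi>cont: "continuous_on B \<psi>"
    using \<psi> Bsub by (meson continuous_at_imp_continuous_on has_derivative_continuous subsetD)
  have gcont: "continuous_on ({-M..M} \<times> {0..H}) (\<lambda>q. g (fst q) (snd q))"
    unfolding g_def
    by (intro continuous_intros continuous_on_compose2[OF \<psi>cont]) (use inB in auto)
  have gcont\<sigma>: "continuous_on {-M..M} (\<lambda>\<sigma>. g \<sigma> h)" if "h \<in> {0..H}" for h
    using that by (intro continuous_at_imp_continuous_on) (use d\<sigma> DERIV_isCont in blast)
  have ne: "{-M..M} \<noteq> {}"
    by (simp add: M_def)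
  define a where "a = \<psi> (0, 0)"
  have m0: "m (0, 0) \<in> {-M..M}"
    using mM[of "(0, 0)"] \<open>r > 0\<close> by (auto simp: B_def)
  have attained: "\<exists>\<sigma>\<in>{-M..M}. g \<sigma> H \<le> a + \<eta> * H" if "\<eta> > 0" for \<eta>
  proof -
    \<comment> \<open>Continuation in the height: \<open>S\<close> collects the heights at which
      some slope keeps g below the line of slope \<eta> through a. The slack \<eta> absorbs the o(k)
      error, and compactness provides a largest such height.\<close>
    define S where "S = snd ` {q \<in> {-M..M} \<times> {0..H}. g (fst q) (snd q) \<le> a + \<eta> * snd q}"
    have memS: "h \<in> S \<longleftrightarrow> h \<in> {0..H} \<and> (\<exists>\<sigma>\<in>{-M..M}. g \<sigma> h \<le> a + \<eta> * h)" for h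
      unfolding S_def by force
    have "closed {q \<in> {-M..M} \<times> {0..H}. g (fst q) (snd q) \<le> a + \<eta> * snd q}"
      by (intro continuous_on_closed_Collect_le gcont continuous_intros closed_Times closed_atLeastAtMost)
    then have "compact ({-M..M} \<times> {0..H} \<inter> {q \<in> {-M..M} \<times> {0..H}. g (fst q) (snd q) \<le> a + \<eta> * snd q})"
      by (intro compact_Int_closed compact_Times) auto
    then have "compact {q \<in> {-M..M} \<times> {0..H}. g (fst q) (snd q) \<le> a + \<eta> * snd q}"
      by (rule back_subst[of compact]) auto
    then have "compact S"
      unfolding S_def by (intro compact_continuous_image continuous_intros)
    moreover have "0 \<in> S"
      using H m0 by (auto simp: memS g_def a_def)
    ultimately obtain h1 where h1: "h1 \<in> S" "\<And>h. h \<in> S \<Longrightarrow> h \<le> h1"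
      using compact_attains_sup[of S] by blast
    have h1H: "h1 \<in> {0..H}"
      using h1(1) memS by blast
    have "h1 = H"
    proof (rule ccontr)
      assume "h1 \<noteq> H"
      then have "h1 < H"
        using h1H by simp
      obtain \<sigma> where \<sigma>: "\<sigma> \<in> {-M..M}" "g \<sigma> h1 \<le> a + \<eta> * h1" "m (- (\<sigma> * h1), h1) = \<sigma>"
      \<comment> \<open>At height 0 every slope gives the value a, so minimality selects nothing;
        the slope \<open>m (0, 0)\<close> is taken because it agrees with m there.\<close>
      proof (cases "h1 = 0")
        case True
        then show thesis
          using that[of "m (0, 0)"] m0 by (auto simp: g_def a_def)
      next
        case False
        then have "h1 > 0"
          using h1H by simp
        obtain \<sigma> where \<sigma>: "\<sigma> \<in> {-M..M}" and min: "\<And>\<tau>. \<tau> \<in> {-M..M} \<Longrightarrow> g \<sigma> h1 \<le> g \<tau> h1"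
          using continuous_attains_inf[OF _ ne gcont\<sigma>[OF h1H]] by auto
        have le: "g \<sigma> h1 \<le> a + \<eta> * h1"
          using h1(1) memS min order_trans by blast
        have mlt: "\<bar>m (- (\<sigma> * h1), h1)\<bar> < M"
          using mM inB \<sigma> h1H by blast
        \<comment> \<open>If the minimiser exceeded m, decreasing it would lower g; there is room to
          do so since \<open>\<sigma> > m > -M\<close>. The opposite inequality is symmetric, so the
          minimiser is a critical point and equals m.\<close>
        have "\<not> \<sigma> > m (- (\<sigma> * h1), h1)"
        proof
          assume gt: "\<sigma> > m (- (\<sigma> * h1), h1)"
          then have "h1 * (\<sigma> - m (- (\<sigma> * h1), h1)) > 0"
            using \<open>h1 > 0\<close> by simp
          from DERIV_pos_inc_left[OF d\<sigma>[OF \<sigma> h1H] this]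
          obtain d where d: "d > 0" "\<And>h. h > 0 \<Longrightarrow> h < d \<Longrightarrow> g (\<sigma> - h) h1 < g \<sigma> h1"
            by blast
          define h where "h = min (d / 2) (\<sigma> + M)"
          have "h > 0" "h < d" "\<sigma> - h \<in> {-M..M}"
            using d(1) gt mlt \<sigma> by (auto simp: h_def)
          then show False
            using d(2) min[of "\<sigma> - h"] by fastforce
        qed
        moreover have "\<not> \<sigma> < m (- (\<sigma> * h1), h1)"
        proof
          assume gt: "\<sigma> < m (- (\<sigma> * h1), h1)"
          then have "h1 * (\<sigma> - m (- (\<sigma> * h1), h1)) < 0"
            using \<open>h1 > 0\<close> by (simp add: mult_pos_neg)
          from DERIV_neg_dec_right[OF d\<sigma>[OF \<sigma> h1H] this]
          obtain d where d: "d > 0" "\<And>h. h > 0 \<Longrightarrow> h < d \<Longrightarrow> g (\<sigma> + h) h1 < g \<sigma> h1"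
            by blast
          define h where "h = min (d / 2) (M - \<sigma>)"
          have "h > 0" "h < d" "\<sigma> + h \<in> {-M..M}"
            using d(1) gt mlt \<sigma> by (auto simp: h_def)
          then show False
            using d(2) min[of "\<sigma> + h"] by fastforce
        qed
        ultimately show thesis
          using that[OF \<sigma> le] by simp
      qed
      have "((\<lambda>h. g \<sigma> h - \<eta> * h) has_real_derivative - \<eta>) (at h1)"
        using dh[OF \<sigma>(1) h1H] \<sigma>(3) by (auto intro!: derivative_eq_intros)
      from DERIV_neg_dec_right[OF this] \<open>\<eta> > 0\<close>
      obtain d where d: "d > 0" "\<And>h. h > 0 \<Longrightarrow> h < d \<Longrightarrow> g \<sigma> (h1 + h) - \<eta> * (h1 + h) < g \<sigma> h1 - \<eta> * h1"
        by auto
      define h where "h = min (d / 2) (H - h1)"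
      have h: "h > 0" "h < d" "h1 + h \<in> {0..H}"
        using d(1) \<open>h1 < H\<close> h1H by (auto simp: h_def)
      then have "h1 + h \<in> S"
        using d(2)[of h] \<sigma>(1,2) memS[of "h1 + h"] by force
      then show False
        using h1(2) h(1) by force
    qed
    with h1(1) memS show ?thesis
      by blast
  qed
  have HH: "H \<in> {0..H}"
    using H by simp
  obtain \<sigma> where \<sigma>: "\<sigma> \<in> {-M..M}" and min: "\<And>\<tau>. \<tau> \<in> {-M..M} \<Longrightarrow> g \<sigma> H \<le> g \<tau> H"
    using continuous_attains_inf[OF _ ne gcont\<sigma>[OF HH]] by auto
  have "g \<sigma> H \<le> a"
  proof (rule field_le_epsilon)
    fix e :: real assume "e > 0"
    then show "g \<sigma> H \<le> a + e"
      using attained[of "e / H"] H(1) min order_trans by fastforce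
  qed
  have mono: "g \<sigma> h \<le> g \<sigma> h'" if "0 \<le> h" "h \<le> h'" "h' \<le> H" for h h'
  proof (rule DERIV_nonneg_imp_nondecreasing[OF that(2)])
    fix x assume "h \<le> x" "x \<le> h'"
    then have "(g \<sigma> has_real_derivative (m (- (\<sigma> * x), x) - \<sigma>)\<^sup>2 / 2) (at x)"
      using that by (intro dh[OF \<sigma>]) auto
    then show "\<exists>y. (g \<sigma> has_real_derivative y) (at x) \<and> 0 \<le> y"
      by (intro exI[of _ "(m (- (\<sigma> * x), x) - \<sigma>)\<^sup>2 / 2"]) simp
  qed
  have const: "g \<sigma> h = a" if "h \<in> {0..H}" for h
    using mono[of 0 h] mono[of h H] that \<open>g \<sigma> H \<le> a\<close> by (simp add: g_def a_def)
  \<comment> \<open>Stopping at \<open>H/2\<close> leaves room above h, where a positive derivative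
    would contradict constancy. The case h = 0 then identifies the minimiser as
    \<open>m (0, 0)\<close>.\<close>
  have m\<sigma>: "m (- (\<sigma> * h), h) = \<sigma>" if "h \<in> {0..H/2}" for h
  proof (rule ccontr)
    assume "m (- (\<sigma> * h), h) \<noteq> \<sigma>"
    then have "(m (- (\<sigma> * h), h) - \<sigma>)\<^sup>2 / 2 > 0"
      by simp
    moreover have "h \<in> {0..H}"
      using that H by auto
    ultimately obtain d where d: "d > 0" "\<And>k. k > 0 \<Longrightarrow> k < d \<Longrightarrow> g \<sigma> h < g \<sigma> (h + k)"
      using DERIV_pos_inc_right[OF dh[OF \<sigma>]] by metis
    define k where "k = min (d / 2) (H / 2)"
    have "k > 0" "k < d" "h + k \<in> {0..H}"
      using d(1) that H by (auto simp: k_def)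
    then show False
      using d(2)[of k] const \<open>h \<in> {0..H}\<close> by simp
  qed
  from m\<sigma>[of 0] H have "m (0, 0) = \<sigma>"
    by simp
  with m\<sigma> H show ?thesis
    by (intro exI[of _ "H/2"]) auto
qed

section \<open>Plane fields whose normal lines are rulings\<close>

lemma open_rectangle:
  fixes x y :: real
  assumes "open S" "(x, y) \<in> S"
  obtains r where "r > 0" "{x - r..x + r} \<times> {y - r..y + r} \<subseteq> S"
proof -
  obtain A B where AB: "open A" "open B" "x \<in> A" "y \<in> B" "A \<times> B \<subseteq> S"
    using assms by (metis open_prod_elim mem_Sigma_iff)
  obtain r1 where r1: "r1 > 0" "cball x r1 \<subseteq> A"
    using AB open_contains_cball by blast
  obtain r2 where r2: "r2 > 0" "cball y r2 \<subseteq> B"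
    using AB open_contains_cball by blast
  show thesis
  proof (rule that)
    show "min r1 r2 > 0"
      using r1 r2 by simp
    have "{x - min r1 r2..x + min r1 r2} \<subseteq> cball x r1" "{y - min r1 r2..y + min r1 r2} \<subseteq> cball y r2"
      by (auto simp: cball_eq_atLeastAtMost)
    then show "{x - min r1 r2..x + min r1 r2} \<times> {y - min r1 r2..y + min r1 r2} \<subseteq> S"
      using AB(5) r1(2) r2(2) by blast
  qed
qed

text \<open>The left side of \<open>ruled\<close> is the inner product of (v, -u) with the
  derivative of (u, v) along (v, -u). So, moving perpendicularly to itself, the field changes only
  along itself, to first order.\<close>

locale ruled_field =
  fixes u v ux uy vx vy :: "real \<times> real \<Rightarrow> real"
  assumes ux: "\<And>x y. ((\<lambda>t. u (t, y)) has_real_derivative ux (x, y)) (at x)"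
    and uy: "\<And>x y. ((\<lambda>t. u (x, t)) has_real_derivative uy (x, y)) (at y)"
    and vx: "\<And>x y. ((\<lambda>t. v (t, y)) has_real_derivative vx (x, y)) (at x)"
    and vy: "\<And>x y. ((\<lambda>t. v (x, t)) has_real_derivative vy (x, y)) (at y)"
    and cont: "continuous_on UNIV u" "continuous_on UNIV v" "continuous_on UNIV ux"
      "continuous_on UNIV uy" "continuous_on UNIV vx" "continuous_on UNIV vy"
    and div: "\<And>p. ux p + vy p = 2"
    and ruled: "\<And>p. (v p)\<^sup>2 * ux p - u p * v p * (uy p + vx p) + (u p)\<^sup>2 * vy p = 0"
begin

text \<open>Where u = 0 this is meant only if ux > 0; it is the limit of v / u there.\<close>

definition slope :: "real \<times> real \<Rightarrow> real" where
  "slope p = (if u p = 0 then vx p / ux p else v p / u p)"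

text \<open>At a zero of the field, w has to annihilate its differential from the left; this is the closure of
  the condition at nonzero points.\<close>

definition characteristic :: "real \<times> real \<Rightarrow> real \<times> real \<Rightarrow> bool" where
  "characteristic p w \<longleftrightarrow> (if u p = 0 \<and> v p = 0
     then fst w * ux p + snd w * vx p = 0 \<and> fst w * uy p + snd w * vy p = 0
     else fst w * u p + snd w * v p = 0)"

section \<open>The zero set of u as a local graph\<close>

lemma u_zero_imp_v_zero:
  assumes "u p = 0" "ux p > 0"
  shows "v p = 0"
  using ruled[of p] assms by simp

lemma u_increasing:
  assumes "x \<le> x'" and "\<And>t. x \<le> t \<Longrightarrow> t \<le> x' \<Longrightarrow> ux (t, y) \<ge> \<kappa>"
  shows "u (x', y) - u (x, y) \<ge> \<kappa> * (x' - x)"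
proof -
  have "u (x, y) - \<kappa> * x \<le> u (x', y) - \<kappa> * x'"
  proof (rule DERIV_nonneg_imp_nondecreasing[OF assms(1)])
    fix t assume t: "x \<le> t" "t \<le> x'"
    have "((\<lambda>t. u (t, y) - \<kappa> * t) has_real_derivative ux (t, y) - \<kappa>) (at t)"
      using ux by (auto intro!: derivative_eq_intros)
    with assms(2)[OF t] show "\<exists>D. ((\<lambda>t. u (t, y) - \<kappa> * t) has_real_derivative D) (at t) \<and> 0 \<le> D"
      by auto
  qed
  then show ?thesis
    by (simp add: algebra_simps)
qed

lemma u_lipschitz_y:
  assumes "y \<in> {c..d}" "y' \<in> {c..d}" and "\<And>t. t \<in> {c..d} \<Longrightarrow> \<bar>uy (x, t)\<bar> \<le> B"
  shows "\<bar>u (x, y) - u (x, y')\<bar> \<le> B * \<bar>y - y'\<bar>"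
proof -
  have "norm (u (x, y) - u (x, y')) \<le> B * norm (y - y')"
    by (rule field_differentiable_bound[of "{c..d}" "\<lambda>t. u (x, t)" "\<lambda>t. uy (x, t)"])
      (use assms uy in \<open>auto intro: has_field_derivative_at_within\<close>)
  then show ?thesis
    by simp
qed

text \<open>An implicit function argument by hand: u is strictly increasing in x and Lipschitz in y.
  The last clause separates boxes without zeros from boxes in which every horizontal section
  contains one.\<close>

lemma zero_graph:
  assumes "u (x0, y0) \<noteq> 0 \<or> ux (x0, y0) > 0"
  obtains a b c d e L where "a < x0" "x0 < b" "c < y0" "y0 < d" "L \<ge> 0"
    "\<And>y z. y \<in> {c..d} \<Longrightarrow> z \<in> {c..d} \<Longrightarrow> \<bar>e y - e z\<bar> \<le> L * \<bar>y - z\<bar>"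
    "\<And>x y. x \<in> {a..b} \<Longrightarrow> y \<in> {c..d} \<Longrightarrow> u (x, y) = 0 \<longleftrightarrow> x = e y"
    "(\<forall>q\<in>{a..b} \<times> {c..d}. u q \<noteq> 0) \<or> (\<forall>q\<in>{a..b} \<times> {c..d}. ux q > 0 \<and> e (snd q) \<in> {a..b})"
proof (cases "u (x0, y0) = 0")
  case False
  have "open {q. u q \<noteq> 0}"
    using cont(1) by (intro open_Collect_neq continuous_intros)
  then obtain r where r: "r > 0" "{x0 - r..x0 + r} \<times> {y0 - r..y0 + r} \<subseteq> {q. u q \<noteq> 0}"
    by (rule open_rectangle) (use False in auto)
  show thesis
  \<comment> \<open>A constant graph just outside the box, since there are no zeros to
    describe.\<close>
  proof (rule that[of "x0 - r" "x0 + r" "y0 - r" "y0 + r" 0 "\<lambda>_. x0 + r + 1"])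
    show "u (x, y) = 0 \<longleftrightarrow> x = x0 + r + 1" if "x \<in> {x0 - r..x0 + r}" "y \<in> {y0 - r..y0 + r}" for x y
      using that subsetD[OF r(2), of "(x, y)"] by auto
  qed (use r in auto)
next
  case True
  define \<kappa> where "\<kappa> = ux (x0, y0) / 2"
  have \<kappa>: "\<kappa> > 0" "\<kappa> < ux (x0, y0)"
    using assms True by (auto simp: \<kappa>_def)
  have "open {q. \<kappa> < ux q}"
    using cont(3) by (intro open_Collect_less continuous_intros)
  then obtain r where r: "r > 0" "{x0 - r..x0 + r} \<times> {y0 - r..y0 + r} \<subseteq> {q. \<kappa> < ux q}"
    by (rule open_rectangle) (use \<kappa> in auto)
  define Q where "Q = {x0 - r..x0 + r} \<times> {y0 - r..y0 + r}"
  have "compact Q"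
    unfolding Q_def by (intro compact_Times) auto
  then have "bounded (uy ` Q)"
    using cont(4) by (intro compact_imp_bounded compact_continuous_image) (auto intro: continuous_on_subset)
  then obtain B where B: "B > 0" "\<And>q. q \<in> Q \<Longrightarrow> \<bar>uy q\<bar> \<le> B"
    by (auto simp: bounded_pos)
  \<comment> \<open>At \<open>y0\<close> the values of u at \<open>x0 - r\<close> and
    \<open>x0 + r\<close> are beyond \<open>\<kappa> * r\<close> in size, with opposite signs. A
    vertical move by s changes u by at most half of that, so the signs persist and the intermediate
    value theorem applies.\<close>
  define s where "s = min r (\<kappa> * r / (2 * B))"
  have s: "s > 0" "s \<le> r"
    using r B \<kappa> by (auto simp: s_def)
  have "B * s \<le> B * (\<kappa> * r / (2 * B))"
    using B by (intro mult_left_mono) (auto simp: s_def)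
  then have Bs: "B * s \<le> \<kappa> * r / 2"
    using B by simp
  define a b c d where "a = x0 - r" and "b = x0 + r" and "c = y0 - s" and "d = y0 + s"
  have sub: "{a..b} \<times> {c..d} \<subseteq> Q"
    using s by (auto simp: Q_def a_def b_def c_def d_def)
  have inc: "\<kappa> * (x' - x) \<le> u (x', y) - u (x, y)" if "x \<in> {a..b}" "x' \<in> {a..b}" "x \<le> x'" "y \<in> {c..d}" for x x' y
  proof (rule u_increasing[OF that(3)])
    fix t assume "x \<le> t" "t \<le> x'"
    then have "(t, y) \<in> Q"
      using that sub by auto
    then show "ux (t, y) \<ge> \<kappa>"
      using subsetD[OF r(2)] by (force simp: Q_def)
  qed
  have lip: "\<bar>u (x, y) - u (x, z)\<bar> \<le> B * \<bar>y - z\<bar>" if "x \<in> {a..b}" "y \<in> {c..d}" "z \<in> {c..d}" for x y z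
    by (rule u_lipschitz_y[OF that(2,3) B(2)]) (use that sub in auto)
  have "\<exists>x\<in>{a..b}. u (x, y) = 0" if y: "y \<in> {c..d}" for y
  proof -
    have By: "B * \<bar>y - y0\<bar> \<le> \<kappa> * r / 2"
    proof -
      have "B * \<bar>y - y0\<bar> \<le> B * s"
        using y B by (intro mult_left_mono) (auto simp: c_def d_def)
      with Bs show ?thesis by simp
    qed
    have \<kappa>r: "\<kappa> * r > 0"
      using r \<kappa> by simp
    have ab: "a \<in> {a..b}" "b \<in> {a..b}" "x0 \<in> {a..b}" "y0 \<in> {c..d}" "a \<le> x0" "x0 \<le> b"
      using r s by (auto simp: a_def b_def c_def d_def)
    have "\<kappa> * r \<le> u (b, y0)"
      using inc[of x0 b y0] ab True by (simp add: b_def)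
    then have ub: "u (b, y) \<ge> 0"
      using lip[of b y y0] ab y By \<kappa>r unfolding abs_le_iff by linarith
    have "\<kappa> * r \<le> - u (a, y0)"
      using inc[of a x0 y0] ab True by (simp add: a_def)
    then have ua: "u (a, y) \<le> 0"
      using lip[of a y y0] ab y By \<kappa>r unfolding abs_le_iff by linarith
    have "continuous_on {a..b} (\<lambda>x. u (x, y))"
      by (intro continuous_on_compose2[OF cont(1)] continuous_intros) auto
    then show ?thesis
      using IVT'[of "\<lambda>x. u (x, y)" a 0 b] ua ub ab by auto
  qed
  then obtain e where e: "\<And>y. y \<in> {c..d} \<Longrightarrow> e y \<in> {a..b}" "\<And>y. y \<in> {c..d} \<Longrightarrow> u (e y, y) = 0"
    by metis
  have inc_abs: "\<kappa> * \<bar>x' - x\<bar> \<le> \<bar>u (x', y) - u (x, y)\<bar>" if "x \<in> {a..b}" "x' \<in> {a..b}" "y \<in> {c..d}" for x x' y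
    using inc[of x x' y] inc[of x' x y] that by (cases "x \<le> x'") (auto simp: abs_if)
  show thesis
  proof (rule that[of a b c d "B / \<kappa>" e])
    show "\<bar>e y - e z\<bar> \<le> B / \<kappa> * \<bar>y - z\<bar>" if "y \<in> {c..d}" "z \<in> {c..d}" for y z
    proof -
      have "\<kappa> * \<bar>e y - e z\<bar> \<le> \<bar>u (e y, z) - u (e z, z)\<bar>"
        using inc_abs e that by blast
      also have "\<dots> = \<bar>u (e y, y) - u (e y, z)\<bar>"
        using e that by simp
      also have "\<dots> \<le> B * \<bar>y - z\<bar>"
        using lip e that by blast
      finally show ?thesis
        using \<kappa> by (simp add: field_simps)
    qed
    show "u (x, y) = 0 \<longleftrightarrow> x = e y" if "x \<in> {a..b}" "y \<in> {c..d}" for x y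
    proof
      assume "u (x, y) = 0"
      then have "\<kappa> * \<bar>x - e y\<bar> \<le> 0"
        using inc_abs[of "e y" x y] e that by simp
      then show "x = e y"
        using \<kappa> by (simp add: mult_le_0_iff)
    qed (use e that in auto)
    have "ux q > 0" if "q \<in> Q" for q
      using that r(2) \<kappa> unfolding Q_def by (meson less_trans mem_Collect_eq subsetD)
    then show "(\<forall>q\<in>{a..b} \<times> {c..d}. u q \<noteq> 0) \<or> (\<forall>q\<in>{a..b} \<times> {c..d}. ux q > 0 \<and> e (snd q) \<in> {a..b})"
      using sub e by fastforce
  qed (use r s B \<kappa> in \<open>auto simp: a_def b_def c_def d_def\<close>)
qed

section \<open>Continuity of the slope across the singular set\<close>

text \<open>Cauchy's mean value theorem on a horizontal segment ending at a common zero of u and v: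
  a version of l'Hopital's rule that holds for all nearby rows at once, which gives joint continuity
  and not only continuity along rows.\<close>

lemma slope_mean_value:
  assumes "u (z, y) = 0" and "\<And>t. min x z \<le> t \<Longrightarrow> t \<le> max x z \<Longrightarrow> ux (t, y) > 0"
  shows "\<exists>\<xi>. min x z \<le> \<xi> \<and> \<xi> \<le> max x z \<and> slope (x, y) = vx (\<xi>, y) / ux (\<xi>, y)"
proof (cases "u (x, y) = 0")
  case True
  then show ?thesis
    by (intro exI[of _ x]) (auto simp: slope_def)
next
  case False
  with assms(1) have "x \<noteq> z"
    by auto
  have z: "v (z, y) = 0"
    using u_zero_imp_v_zero assms by auto
  have "\<exists>\<xi>. min x z < \<xi> \<and> \<xi> < max x z \<and>
      (v (max x z, y) - v (min x z, y)) * ux (\<xi>, y) = (u (max x z, y) - u (min x z, y)) * vx (\<xi>, y)"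
    using \<open>x \<noteq> z\<close> ux vx by (intro GMVT') (auto intro: DERIV_isCont[OF ux] DERIV_isCont[OF vx])
  then obtain \<xi> where \<xi>: "min x z \<le> \<xi>" "\<xi> \<le> max x z" and
      eq: "(v (max x z, y) - v (min x z, y)) * ux (\<xi>, y) = (u (max x z, y) - u (min x z, y)) * vx (\<xi>, y)"
    by (meson less_imp_le)
  have "v (x, y) * ux (\<xi>, y) = u (x, y) * vx (\<xi>, y)"
    using eq z assms(1) by (cases "x \<le> z") (auto simp: max_def min_def)
  with False assms(2)[OF \<xi>] have "slope (x, y) = vx (\<xi>, y) / ux (\<xi>, y)"
    by (simp add: slope_def frac_eq_eq mult.commute)
  with \<xi> show ?thesis
    by blast
qed

lemma slope_chart:
  assumes "u (x0, y0) \<noteq> 0 \<or> ux (x0, y0) > 0"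
  obtains a b c d e L where "a < x0" "x0 < b" "c < y0" "y0 < d"
    "burgers_off_graph slope (\<lambda>q. (vx q * u q - v q * ux q) / (u q)\<^sup>2) e L a b c d"
    "\<And>q. q \<in> {a..b} \<times> {c..d} \<Longrightarrow> u q = 0 \<Longrightarrow> ux q > 0"
proof -
  obtain a b c d e L where box: "a < x0" "x0 < b" "c < y0" "y0 < d" and L: "L \<ge> 0"
    and e: "\<And>y z. y \<in> {c..d} \<Longrightarrow> z \<in> {c..d} \<Longrightarrow> \<bar>e y - e z\<bar> \<le> L * \<bar>y - z\<bar>"
    and zero: "\<And>x y. x \<in> {a..b} \<Longrightarrow> y \<in> {c..d} \<Longrightarrow> u (x, y) = 0 \<longleftrightarrow> x = e y"
    and alt: "(\<forall>q\<in>{a..b} \<times> {c..d}. u q \<noteq> 0) \<or> (\<forall>q\<in>{a..b} \<times> {c..d}. ux q > 0 \<and> e (snd q) \<in> {a..b})"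
    by (rule zero_graph[OF assms]) (rule that; assumption)
  define Q where "Q = {a..b} \<times> {c..d}"
  have pos: "ux q > 0" if "q \<in> Q" "u q = 0" for q
    using that alt by (auto simp: Q_def)
  have cu: "isCont u q" and cv: "isCont v q" and cux: "isCont ux q" and cvx: "isCont vx q" for q
    using cont by (simp_all add: continuous_on_eq_continuous_at del: split_paired_All)
  have cont_slope: "continuous_on Q slope"
    unfolding continuous_on_eq_continuous_within
  proof
    fix q assume q: "q \<in> Q"
    show "continuous (at q within Q) slope"
    proof (cases "u q = 0")
      case False
      have "isCont (\<lambda>p. v p / u p) q"
        using False cu cv by (intro continuous_intros) auto
      moreover have "open {p. u p \<noteq> 0}"
        by (intro open_Collect_neq cont(1) continuous_intros)
      then have "\<forall>\<^sub>F p in nhds q. slope p = v p / u p"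
        using False by (auto simp: eventually_nhds slope_def intro!: exI[of _ "{p. u p \<noteq> 0}"])
      ultimately have "isCont slope q"
        by (subst isCont_cong[of slope "\<lambda>p. v p / u p"])
      then show ?thesis
        by (rule continuous_at_imp_continuous_at_within)
    next
      case True
      obtain x y where xy: "q = (x, y)"
        by (cases q)
      have ex: "x = e y"
        using zero[of x y] q True xy by (auto simp: Q_def)
      from alt True q have posQ: "\<And>p. p \<in> Q \<Longrightarrow> ux p > 0" and eQ: "\<And>y. y \<in> {c..d} \<Longrightarrow> e y \<in> {a..b}"
        using box by (auto simp: Q_def)
      define \<rho> where "\<rho> p = vx p / ux p" for p
      have \<rho>: "isCont \<rho> q"
        unfolding \<rho>_def using posQ[OF q] cux cvx by (intro continuous_intros) auto
      have slope_q: "slope q = \<rho> q"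
        using True by (simp add: slope_def \<rho>_def)
      show ?thesis
        unfolding continuous_within_eps_delta
      proof (intro allI impI)
        fix \<epsilon> :: real assume "\<epsilon> > 0"
        with \<rho> obtain \<eta> where \<eta>: "\<eta> > 0" "\<And>p. dist p q < \<eta> \<Longrightarrow> dist (\<rho> p) (\<rho> q) < \<epsilon>"
          unfolding continuous_at_eps_delta by blast
        \<comment> \<open>From p the row is followed to the graph. The intermediate point is off
          horizontally by at most \<open>\<delta> + L * \<delta>\<close> and vertically by less than
          \<delta>, hence the factor \<open>L + 2\<close>.\<close>
        define \<delta> where "\<delta> = \<eta> / (L + 2)"
        have \<delta>: "\<delta> > 0" "(L + 2) * \<delta> = \<eta>"
          using L \<eta> by (auto simp: \<delta>_def)
        have "dist (slope p) (slope q) < \<epsilon>" if p: "p \<in> Q" "dist p q < \<delta>" for p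
        proof -
          obtain x' y' where xy': "p = (x', y')"
            by (cases p)
          have y': "y' \<in> {c..d}" "x' \<in> {a..b}" "y \<in> {c..d}"
            using p q by (auto simp: xy' xy Q_def)
          have dx: "\<bar>x' - e y\<bar> < \<delta>" and dy: "\<bar>y' - y\<bar> < \<delta>"
            using p(2) dist_fst_le[of p q] dist_snd_le[of p q] by (auto simp: xy xy' ex dist_real_def)
          have "u (e y', y') = 0"
            using zero eQ y' by blast
          moreover have "ux (t, y') > 0" if "min x' (e y') \<le> t" "t \<le> max x' (e y')" for t
            using that y' eQ[OF y'(1)] by (intro posQ) (auto simp: Q_def)
          ultimately obtain \<xi> where \<xi>: "min x' (e y') \<le> \<xi>" "\<xi> \<le> max x' (e y')" "slope (x', y') = \<rho> (\<xi>, y')"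
            unfolding \<rho>_def using slope_mean_value by metis
          have "\<bar>e y' - e y\<bar> \<le> L * \<delta>"
            using e[OF y'(1,3)] dy L by (meson less_imp_le mult_left_mono order_trans)
          then have "\<bar>\<xi> - e y\<bar> \<le> \<delta> + L * \<delta>"
            using \<xi>(1,2) dx \<delta>(1) L by (auto simp: min_def max_def abs_le_iff split: if_splits)
          moreover have "dist (\<xi>, y') q \<le> \<bar>\<xi> - e y\<bar> + \<bar>y' - y\<bar>"
            using sqrt_sum_squares_le_sum_abs[of "\<xi> - e y" "y' - y"] by (simp add: xy ex dist_Pair_Pair dist_real_def)
          ultimately have "dist (\<xi>, y') q < \<eta>"
            using dy \<delta>(2) by (simp add: algebra_simps)
          then show ?thesis
            using \<eta>(2) \<xi>(3) slope_q xy' by simp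
        qed
        with \<delta>(1) show "\<exists>\<delta>>0. \<forall>p\<in>Q. dist p q < \<delta> \<longrightarrow> dist (slope p) (slope q) < \<epsilon>"
          by blast
      qed
    qed
  qed
  have "burgers_off_graph slope (\<lambda>q. (vx q * u q - v q * ux q) / (u q)\<^sup>2) e L a b c d"
  proof
    show "a < b" "c < d"
      using box by auto
    show "continuous_on {p \<in> {a..b} \<times> {c..d}. fst p \<noteq> e (snd p)} (\<lambda>q. (vx q * u q - v q * ux q) / (u q)\<^sup>2)"
      using zero by (intro continuous_intros continuous_on_subset[OF cont(1)] continuous_on_subset[OF cont(2)]
          continuous_on_subset[OF cont(3)] continuous_on_subset[OF cont(5)]) auto
    fix x y assume xy: "x \<in> {a..b}" "y \<in> {c..d}" "x \<noteq> e y"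
    then have u: "u (x, y) \<noteq> 0"
      using zero by blast
    have ev: "((\<lambda>t. slope (t, y)) has_real_derivative D) (at x)"
      if "((\<lambda>t. v (t, y) / u (t, y)) has_real_derivative D) (at x)" for D
    proof (rule has_field_derivative_transform_within_open[OF that])
      show "open {t. u (t, y) \<noteq> 0}"
        by (intro open_Collect_neq continuous_on_compose2[OF cont(1)] continuous_intros) auto
    qed (use u in \<open>auto simp: slope_def\<close>)
    show "((\<lambda>t. slope (t, y)) has_real_derivative (vx (x, y) * u (x, y) - v (x, y) * ux (x, y)) / (u (x, y))\<^sup>2) (at x)"
      by (rule ev, rule DERIV_cong, rule DERIV_divide[OF vx ux u]) (simp add: power2_eq_square)
    have ev: "((\<lambda>t. slope (x, t)) has_real_derivative D) (at y)"
      if "((\<lambda>t. v (x, t) / u (x, t)) has_real_derivative D) (at y)" for D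
    proof (rule has_field_derivative_transform_within_open[OF that])
      show "open {t. u (x, t) \<noteq> 0}"
        by (intro open_Collect_neq continuous_on_compose2[OF cont(1)] continuous_intros) auto
    qed (use u in \<open>auto simp: slope_def\<close>)
    \<comment> \<open>Burgers' equation is \<open>ruled\<close> divided by u^3, after separating the
      terms with \<open>ux\<close> and \<open>vx\<close> from those with \<open>uy\<close> and
      \<open>vy\<close>.\<close>
    have "slope (x, y) * ((vx (x, y) * u (x, y) - v (x, y) * ux (x, y)) / (u (x, y))\<^sup>2) =
        (v (x, y) * (vx (x, y) * u (x, y) - v (x, y) * ux (x, y))) / (u (x, y) * (u (x, y) * u (x, y)))"
      using u by (simp add: slope_def power2_eq_square)
    also have "v (x, y) * (vx (x, y) * u (x, y) - v (x, y) * ux (x, y)) =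
        u (x, y) * (vy (x, y) * u (x, y) - v (x, y) * uy (x, y))"
      using ruled[of "(x, y)"] by (simp add: power2_eq_square algebra_simps)
    finally have "(vy (x, y) * u (x, y) - v (x, y) * uy (x, y)) / (u (x, y) * u (x, y)) =
        slope (x, y) * ((vx (x, y) * u (x, y) - v (x, y) * ux (x, y)) / (u (x, y))\<^sup>2)"
      using u by simp
    then show "((\<lambda>t. slope (x, t)) has_real_derivative
        slope (x, y) * ((vx (x, y) * u (x, y) - v (x, y) * ux (x, y)) / (u (x, y))\<^sup>2)) (at y)"
      by (intro ev DERIV_cong[OF DERIV_divide[OF vy uy u]])
  qed (use L e cont_slope in \<open>auto simp: Q_def\<close>)
  with box pos show thesis
    by (intro that) (auto simp: Q_def)
qed

lemma slope_regular_near: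
  assumes "u p \<noteq> 0 \<or> ux p > 0"
  shows isCont_slope: "isCont slope p"
    and zero_near: "\<forall>\<^sub>F q in nhds p. u q = 0 \<longrightarrow> ux q > 0"
proof -
  obtain x0 y0 where p: "p = (x0, y0)"
    by (cases p)
  obtain a b c d e L where box: "a < x0" "x0 < b" "c < y0" "y0 < d"
    and "burgers_off_graph slope (\<lambda>q. (vx q * u q - v q * ux q) / (u q)\<^sup>2) e L a b c d"
    and pos: "\<And>q. q \<in> {a..b} \<times> {c..d} \<Longrightarrow> u q = 0 \<Longrightarrow> ux q > 0"
    by (rule slope_chart[OF assms[unfolded p]]) (rule that; assumption)
  then interpret burgers_off_graph slope "\<lambda>q. (vx q * u q - v q * ux q) / (u q)\<^sup>2" e L a b c d
    by simp
  have op: "open ({a<..<b} \<times> {c<..<d})" "p \<in> {a<..<b} \<times> {c<..<d}"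
    using box by (auto simp: p intro: open_Times)
  have "{a<..<b} \<times> {c<..<d} \<subseteq> {a..b} \<times> {c..d}"
    by auto
  then have "continuous_on ({a<..<b} \<times> {c<..<d}) slope"
    by (rule continuous_on_subset[OF burgers_off_graph.cont[OF burgers_off_graph_axioms]])
  with op show "isCont slope p"
    using continuous_on_eq_continuous_at by blast
  show "\<forall>\<^sub>F q in nhds p. u q = 0 \<longrightarrow> ux q > 0"
    unfolding eventually_nhds using op pos by (intro exI[of _ "{a<..<b} \<times> {c<..<d}"]) auto
qed

section \<open>Characteristic directions in a chart\<close>

text \<open>Near p one has \<open>v = slope * u\<close>, also at zeros, where both sides vanish.
  Continuity of the slope then passes to the limit in the difference quotients. With the definition
  of \<open>slope\<close> this makes the differential of v at p a multiple of that of u, so the two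
  conditions in \<open>characteristic\<close> agree there.\<close>

lemma vy_eq_slope:
  assumes "u p = 0" "ux p > 0"
  shows "vy p = slope p * uy p"
proof -
  obtain x y where p: "p = (x, y)"
    by (cases p)
  have vp: "v p = 0"
    using u_zero_imp_v_zero assms by blast
  have tend: "((\<lambda>t. (x, t)) \<longlongrightarrow> p) (at y)"
    unfolding p by (intro tendsto_intros)
  have "((\<lambda>t. slope (x, t) * ((u (x, t) - u (x, y)) / (t - y))) \<longlongrightarrow> slope p * uy p) (at y)"
    using uy[of x y] unfolding has_field_derivative_iff p[symmetric]
    by (intro tendsto_mult isCont_tendsto_compose[OF isCont_slope tend]) (use assms in auto)
  moreover have "\<forall>\<^sub>F t in at y. slope (x, t) * ((u (x, t) - u (x, y)) / (t - y)) = (v (x, t) - v (x, y)) / (t - y)"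
  proof -
    have "\<forall>\<^sub>F t in at y. u (x, t) = 0 \<longrightarrow> ux (x, t) > 0"
      using tend zero_near assms unfolding filterlim_iff by blast
    then show ?thesis
      by eventually_elim
        (use assms vp u_zero_imp_v_zero in \<open>auto simp: slope_def p\<close>)
  qed
  ultimately have "((\<lambda>t. (v (x, t) - v (x, y)) / (t - y)) \<longlongrightarrow> slope p * uy p) (at y)"
    by (rule Lim_transform_eventually)
  moreover have "((\<lambda>t. (v (x, t) - v (x, y)) / (t - y)) \<longlongrightarrow> vy p) (at y)"
    using vy[of x y] by (simp add: has_field_derivative_iff p)
  ultimately show ?thesis
    using tendsto_unique[of "at y"] by force
qed

lemma characteristic_iff_slope:
  assumes "u p = 0 \<longrightarrow> ux p > 0"
  shows "characteristic p w \<longleftrightarrow> fst w + slope p * snd w = 0"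
proof (cases "u p = 0")
  case False
  then show ?thesis
    by (simp add: characteristic_def slope_def field_simps)
next
  case True
  with assms have pos: "ux p > 0"
    by blast
  then have vx: "vx p = slope p * ux p"
    using True by (simp add: slope_def)
  have "fst w * ux p + snd w * vx p = (fst w + slope p * snd w) * ux p"
    "fst w * uy p + snd w * vy p = (fst w + slope p * snd w) * uy p"
    unfolding vx vy_eq_slope[OF True pos] by (simp_all add: algebra_simps)
  then show ?thesis
    using True u_zero_imp_v_zero[OF True pos] pos by (auto simp: characteristic_def)
qed

lemma not_characteristic_near:
  assumes "u p \<noteq> 0 \<or> ux p > 0" and "\<not> characteristic p w"
  shows "\<forall>\<^sub>F q in nhds p. \<not> characteristic q w"
proof -
  have "isCont (\<lambda>q. fst w + slope q * snd w) p"
    by (intro continuous_intros isCont_slope assms)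
  then have "((\<lambda>q. fst w + slope q * snd w) \<longlongrightarrow> fst w + slope p * snd w) (nhds p)"
    using tendsto_at_iff_tendsto_nhds[of "\<lambda>q. fst w + slope q * snd w" p] by (simp add: isCont_def)
  moreover have "fst w + slope p * snd w \<noteq> 0"
    using assms characteristic_iff_slope by blast
  ultimately have "\<forall>\<^sub>F q in nhds p. fst w + slope q * snd w \<noteq> 0"
    by (rule tendsto_imp_eventually_ne)
  with zero_near[OF assms(1)] show ?thesis
    by eventually_elim (use characteristic_iff_slope in blast)
qed

lemma slope_constant_along:
  assumes "u (x0, y0) \<noteq> 0 \<or> ux (x0, y0) > 0"
  shows "\<exists>H>0. \<forall>t. \<bar>t\<bar> \<le> H \<longrightarrow> slope (x0 - slope (x0, y0) * t, y0 + t) = slope (x0, y0)"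
proof -
  obtain a b c d e L where box: "a < x0" "x0 < b" "c < y0" "y0 < d"
    and "burgers_off_graph slope (\<lambda>q. (vx q * u q - v q * ux q) / (u q)\<^sup>2) e L a b c d"
    by (rule slope_chart[OF assms]) (rule that; assumption)
  then interpret burgers_off_graph slope "\<lambda>q. (vx q * u q - v q * ux q) / (u q)\<^sup>2" e L a b c d
    by simp
  obtain \<psi> where \<psi>: "\<And>p. p \<in> {a<..<b} \<times> {c<..<d} \<Longrightarrow>
      (\<psi> has_derivative (\<lambda>h. slope p * fst h + (slope p)\<^sup>2 / 2 * snd h)) (at p)"
    using potential by blast
  define r where "r = Min {x0 - a, b - x0, y0 - c, d - y0}"
  have "r > 0"
    using box by (simp add: r_def)
  have r: "r \<le> x0 - a" "r \<le> b - x0" "r \<le> y0 - c" "r \<le> d - y0"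
    by (auto simp: r_def)
  \<comment> \<open>The Hamilton-Jacobi lemma only moves towards larger y. The point reflection
    \<epsilon> = -1 preserves the equation once the potential is multiplied by \<epsilon>, and
    supplies the other half of the segment.\<close>
  have "\<exists>H>0. \<forall>t\<in>{0..H}. slope (x0 - \<epsilon> * slope (x0, y0) * t, y0 + \<epsilon> * t) = slope (x0, y0)"
    if \<epsilon>: "\<epsilon> = 1 \<or> \<epsilon> = -1" for \<epsilon> :: real
  proof -
    define m where "m q = slope (x0 + \<epsilon> * fst q, y0 + \<epsilon> * snd q)" for q
    have sub: "(x0 + \<epsilon> * fst q, y0 + \<epsilon> * snd q) \<in> {a<..<b} \<times> {c<..<d}"
      if "q \<in> {-r<..<r} \<times> {-r<..<r}" for q
      using that \<epsilon> r by auto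
    have "\<exists>H>0. \<forall>t\<in>{0..H}. m (- m (0, 0) * t, t) = m (0, 0)"
    proof (rule hamilton_jacobi_characteristic[OF \<open>r > 0\<close>])
      fix q assume "q \<in> {-r<..<r} \<times> {-r<..<r}"
      note D = \<psi>[OF sub[OF this]]
      have "((\<lambda>q. \<psi> (x0 + \<epsilon> * fst q, y0 + \<epsilon> * snd q)) has_derivative
          (\<lambda>h. m q * fst (\<epsilon> * fst h, \<epsilon> * snd h) + (m q)\<^sup>2 / 2 * snd (\<epsilon> * fst h, \<epsilon> * snd h))) (at q)"
        unfolding m_def
        by (rule has_derivative_compose[where f="\<lambda>q. (x0 + \<epsilon> * fst q, y0 + \<epsilon> * snd q)", OF _ D])
          (auto intro!: derivative_eq_intros)
      then have "((\<lambda>q. \<epsilon> * \<psi> (x0 + \<epsilon> * fst q, y0 + \<epsilon> * snd q)) has_derivative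
          (\<lambda>h. \<epsilon> * (m q * (\<epsilon> * fst h) + (m q)\<^sup>2 / 2 * (\<epsilon> * snd h)))) (at q)"
        unfolding fst_conv snd_conv by (rule has_derivative_mult_right)
      moreover have "\<epsilon> * (m q * (\<epsilon> * fst h) + (m q)\<^sup>2 / 2 * (\<epsilon> * snd h)) = m q * fst h + (m q)\<^sup>2 / 2 * snd h" for h
        using \<epsilon> by auto
      ultimately show "((\<lambda>q. \<epsilon> * \<psi> (x0 + \<epsilon> * fst q, y0 + \<epsilon> * snd q)) has_derivative
          (\<lambda>h. m q * fst h + (m q)\<^sup>2 / 2 * snd h)) (at q)"
        by simp
    next
      show "continuous_on ({-r<..<r} \<times> {-r<..<r}) m"
        unfolding m_def
        by (rule continuous_on_compose2[OF burgers_off_graph.cont[OF burgers_off_graph_axioms]])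
          (use sub in \<open>fastforce intro!: continuous_intros\<close>)+
    qed
    then show ?thesis
      by (simp add: m_def mult.assoc)
  qed
  from this[of 1] this[of "-1"] obtain H1 H2 where
    "H1 > 0" and H1: "\<And>t. t \<in> {0..H1} \<Longrightarrow> slope (x0 - slope (x0, y0) * t, y0 + t) = slope (x0, y0)" and
    "H2 > 0" and H2: "\<And>t. t \<in> {0..H2} \<Longrightarrow> slope (x0 + slope (x0, y0) * t, y0 - t) = slope (x0, y0)"
    by auto
  show ?thesis
  proof (intro exI conjI allI impI)
    show "min H1 H2 > 0"
      using \<open>H1 > 0\<close> \<open>H2 > 0\<close> by simp
    fix t assume "\<bar>t\<bar> \<le> min H1 H2"
    then show "slope (x0 - slope (x0, y0) * t, y0 + t) = slope (x0, y0)"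
      using H1[of t] H2[of "-t"] by (cases "t \<ge> 0") auto
  qed
qed

lemma characteristic_along_near:
  assumes "u p \<noteq> 0 \<or> ux p > 0" and "characteristic p w"
  shows "\<forall>\<^sub>F t in nhds 0. characteristic (p + t *\<^sub>R w) w"
proof -
  obtain x0 y0 where p: "p = (x0, y0)"
    by (cases p)
  have w: "fst w = - slope p * snd w"
    using assms characteristic_iff_slope[of p w] by auto
  obtain H where "H > 0" and H: "\<And>t. \<bar>t\<bar> \<le> H \<Longrightarrow> slope (x0 - slope p * t, y0 + t) = slope p"
    using slope_constant_along assms(1) unfolding p by blast
  have line: "p + t *\<^sub>R w = (x0 - slope p * (t * snd w), y0 + t * snd w)" for t
    by (simp add: p prod_eq_iff w)
  have "((\<lambda>t. t * snd w) \<longlongrightarrow> 0 * snd w) (nhds 0)"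
    by (intro tendsto_intros filterlim_ident)
  then have "\<forall>\<^sub>F t in nhds 0. dist (t * snd w) 0 < H"
    using \<open>H > 0\<close> by (intro tendstoD) simp_all
  moreover have "((\<lambda>t. p + t *\<^sub>R w) \<longlongrightarrow> p + 0 *\<^sub>R w) (nhds 0)"
    by (intro tendsto_intros filterlim_ident)
  then have "filterlim (\<lambda>t. p + t *\<^sub>R w) (nhds p) (nhds 0)"
    by simp
  then have "\<forall>\<^sub>F t in nhds 0. u (p + t *\<^sub>R w) = 0 \<longrightarrow> ux (p + t *\<^sub>R w) > 0"
    using zero_near[OF assms(1)] unfolding filterlim_iff by blast
  ultimately show ?thesis
  proof eventually_elim
    case (elim t)
    then have "slope (p + t *\<^sub>R w) = slope p"
      unfolding line by (intro H) simp
    with elim w show ?case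
      by (simp add: characteristic_iff_slope)
  qed
qed

section \<open>Exchanging the coordinates, and continuation along whole lines\<close>

text \<open>Reflection in the diagonal carries the chart with \<open>vy > 0\<close> to the one with
  \<open>ux > 0\<close>, so only the latter has to be treated.\<close>

lemma ruled_field_swap:
  "ruled_field (v \<circ> prod.swap) (u \<circ> prod.swap) (vy \<circ> prod.swap) (vx \<circ> prod.swap) (uy \<circ> prod.swap) (ux \<circ> prod.swap)"
proof
  have c: "continuous_on UNIV (g \<circ> prod.swap)" if "continuous_on UNIV g" for g :: "real \<times> real \<Rightarrow> real"
    unfolding prod.swap_def o_def
    by (intro continuous_on_compose2[OF that] continuous_intros) auto
  show "continuous_on UNIV (v \<circ> prod.swap)" "continuous_on UNIV (u \<circ> prod.swap)"
    "continuous_on UNIV (vy \<circ> prod.swap)" "continuous_on UNIV (vx \<circ> prod.swap)"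
    "continuous_on UNIV (uy \<circ> prod.swap)" "continuous_on UNIV (ux \<circ> prod.swap)"
    by (intro c cont)+
  show "(vy \<circ> prod.swap) p + (ux \<circ> prod.swap) p = 2" for p
    using div[of "prod.swap p"] by simp
  show "((u \<circ> prod.swap) p)\<^sup>2 * (vy \<circ> prod.swap) p - (v \<circ> prod.swap) p * (u \<circ> prod.swap) p *
      ((vx \<circ> prod.swap) p + (uy \<circ> prod.swap) p) + ((v \<circ> prod.swap) p)\<^sup>2 * (ux \<circ> prod.swap) p = 0" for p
    using ruled[of "prod.swap p"] by (simp add: algebra_simps)
qed (use ux uy vx vy in auto)

text \<open>The reason for stating the condition without quotients: it is the same in both charts,
  so local results obtained in either one can be combined along a line.\<close>

lemma characteristic_swap:
  "ruled_field.characteristic (v \<circ> prod.swap) (u \<circ> prod.swap) (vy \<circ> prod.swap) (vx \<circ> prod.swap)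
    (uy \<circ> prod.swap) (ux \<circ> prod.swap) (prod.swap p) (prod.swap w) \<longleftrightarrow> characteristic p w"
  by (auto simp: ruled_field.characteristic_def[OF ruled_field_swap] characteristic_def add.commute)

lemma chart_or_swapped_chart:
  "(u p \<noteq> 0 \<or> ux p > 0) \<or> (v p \<noteq> 0 \<or> vy p > 0)"
  using div[of p] by linarith

lemma eventually_not_characteristic:
  assumes "\<not> characteristic p w"
  shows "\<forall>\<^sub>F q in nhds p. \<not> characteristic q w"
  using chart_or_swapped_chart[of p]
proof
  assume "v p \<noteq> 0 \<or> vy p > 0"
  then have "\<forall>\<^sub>F q in nhds (prod.swap p). \<not> ruled_field.characteristic (v \<circ> prod.swap) (u \<circ> prod.swap)
      (vy \<circ> prod.swap) (vx \<circ> prod.swap) (uy \<circ> prod.swap) (ux \<circ> prod.swap) q (prod.swap w)"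
    by (intro ruled_field.not_characteristic_near[OF ruled_field_swap]) (use assms characteristic_swap in auto)
  moreover have "filterlim prod.swap (nhds (prod.swap p)) (nhds p)"
    unfolding prod.swap_def by (intro tendsto_intros filterlim_ident)
  ultimately have "\<forall>\<^sub>F q in nhds p. \<not> ruled_field.characteristic (v \<circ> prod.swap) (u \<circ> prod.swap)
      (vy \<circ> prod.swap) (vx \<circ> prod.swap) (uy \<circ> prod.swap) (ux \<circ> prod.swap) (prod.swap q) (prod.swap w)"
    unfolding filterlim_iff by blast
  then show ?thesis
    by (simp only: characteristic_swap)
qed (rule not_characteristic_near[OF _ assms])

lemma eventually_characteristic_along:
  assumes "characteristic p w"
  shows "\<forall>\<^sub>F t in nhds 0. characteristic (p + t *\<^sub>R w) w"
  using chart_or_swapped_chart[of p]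
proof
  assume "v p \<noteq> 0 \<or> vy p > 0"
  then have "\<forall>\<^sub>F t in nhds 0. ruled_field.characteristic (v \<circ> prod.swap) (u \<circ> prod.swap)
      (vy \<circ> prod.swap) (vx \<circ> prod.swap) (uy \<circ> prod.swap) (ux \<circ> prod.swap)
      (prod.swap p + t *\<^sub>R prod.swap w) (prod.swap w)"
    by (intro ruled_field.characteristic_along_near[OF ruled_field_swap]) (use assms characteristic_swap in auto)
  moreover have "prod.swap p + t *\<^sub>R prod.swap w = prod.swap (p + t *\<^sub>R w)" for t
    by (simp add: prod_eq_iff)
  ultimately show ?thesis
    by (simp only: characteristic_swap)
qed (rule characteristic_along_near[OF _ assms])

text \<open>With w fixed, the parameters at which w is characteristic form an open set with open
  complement, and the real line is connected. Both kinds of openness hold at singular points too, so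
  the line does not stop there.\<close>

lemma characteristic_line:
  assumes "characteristic p w"
  shows "characteristic (p + t *\<^sub>R w) w"
proof -
  define S where "S = {t. characteristic (p + t *\<^sub>R w) w}"
  have "open S"
  proof (subst open_subopen, rule ballI)
    fix t assume "t \<in> S"
    then have "\<forall>\<^sub>F s in nhds 0. characteristic (p + t *\<^sub>R w + s *\<^sub>R w) w"
      by (intro eventually_characteristic_along) (simp add: S_def)
    moreover have "filterlim (\<lambda>s. s - t) (nhds (t - t)) (nhds t)"
      by (intro tendsto_intros filterlim_ident)
    then have "filterlim (\<lambda>s. s - t) (nhds 0) (nhds t)"
      by simp
    ultimately have "\<forall>\<^sub>F s in nhds t. characteristic (p + t *\<^sub>R w + (s - t) *\<^sub>R w) w"
      by (rule eventually_compose_filterlim)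
    then have "\<forall>\<^sub>F s in nhds t. s \<in> S"
      by (simp add: S_def scaleR_diff_left)
    then show "\<exists>T. open T \<and> t \<in> T \<and> T \<subseteq> S"
      by (auto simp: eventually_nhds)
  qed
  moreover have "open (- S)"
  proof (subst open_subopen, rule ballI)
    fix t assume "t \<in> - S"
    then have "\<forall>\<^sub>F q in nhds (p + t *\<^sub>R w). \<not> characteristic q w"
      by (intro eventually_not_characteristic) (simp add: S_def)
    moreover have "filterlim (\<lambda>s. p + s *\<^sub>R w) (nhds (p + t *\<^sub>R w)) (nhds t)"
      by (intro tendsto_intros filterlim_ident)
    ultimately have "\<forall>\<^sub>F s in nhds t. \<not> characteristic (p + s *\<^sub>R w) w"
      by (rule eventually_compose_filterlim)
    then have "\<forall>\<^sub>F s in nhds t. s \<in> - S"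
      by (simp add: S_def)
    then show "\<exists>T. open T \<and> t \<in> T \<and> T \<subseteq> - S"
      by (auto simp: eventually_nhds)
  qed
  moreover have "0 \<in> S"
    using assms by (simp add: S_def)
  ultimately have "S = UNIV"
    using clopen[of S] by (auto simp: closed_def)
  then show ?thesis
    by (auto simp: S_def)
qed

text \<open>Both vectors are orthogonal to one and the same nonzero vector: (u, v), or at a zero of
  the field (\<open>ux\<close>, \<open>vx\<close>) or (\<open>uy\<close>, \<open>vy\<close>), one of
  which is nonzero by \<open>div\<close>.\<close>

lemma characteristic_parallel:
  assumes "characteristic p w" "characteristic p w'"
  shows "fst w * snd w' = snd w * fst w'"
proof -
  have det: "fst w * snd w' = snd w * fst w'"
    if "fst w * \<alpha> + snd w * \<beta> = 0" "fst w' * \<alpha> + snd w' * \<beta> = 0" "\<alpha> \<noteq> 0 \<or> \<beta> \<noteq> 0" for \<alpha> \<beta>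
  proof -
    have "(fst w * snd w' - snd w * fst w') * \<alpha> = 0" "(fst w * snd w' - snd w * fst w') * \<beta> = 0"
      using that(1,2) by algebra+
    with that(3) show ?thesis
      by auto
  qed
  show ?thesis
  proof (cases "u p = 0 \<and> v p = 0")
    case True
    then have *: "fst w * ux p + snd w * vx p = 0" "fst w * uy p + snd w * vy p = 0"
      "fst w' * ux p + snd w' * vx p = 0" "fst w' * uy p + snd w' * vy p = 0"
      using assms by (simp_all add: characteristic_def)
    have "ux p \<noteq> 0 \<or> vy p \<noteq> 0"
      using div[of p] by auto
    then show ?thesis
      using det[OF *(1,3)] det[OF *(2,4)] by blast
  next
    case False
    then show ?thesis
      using assms by (intro det[of "u p" "v p"]) (auto simp: characteristic_def)
  qed
qed

theorem constant_direction: "\<exists>w. w \<noteq> (0, 0) \<and> (\<forall>p. fst w * u p + snd w * v p = 0)"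
proof (cases "\<exists>p. (u p, v p) \<noteq> (0, 0)")
  case True
  then obtain p where p: "(u p, v p) \<noteq> (0, 0)"
    by blast
  have "v p * u q - u p * v q = 0" for q
  proof (cases "u q = 0 \<and> v q = 0")
    case False
    define w where "w = (v p, - u p)"
    define w' where "w' = (v q, - u q)"
    have w: "characteristic p w" "characteristic q w'"
      using p False by (auto simp: characteristic_def w_def w'_def)
    show ?thesis
    proof (rule ccontr)
      assume D: "v p * u q - u p * v q \<noteq> 0"
      define D where "D = v p * u q - u p * v q"
      define \<delta>1 \<delta>2 where "\<delta>1 = fst q - fst p" and "\<delta>2 = snd q - snd p"
      \<comment> \<open>Cramer's rule for the intersection of the lines through p and q, with the
        cross product D as determinant. The intersection may be a singular point, where
        \<open>characteristic_parallel\<close> still applies.\<close>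
      define t where "t = (u q * \<delta>1 + v q * \<delta>2) / D"
      define s where "s = (u p * \<delta>1 + v p * \<delta>2) / D"
      have tD: "t * D = u q * \<delta>1 + v q * \<delta>2" and sD: "s * D = u p * \<delta>1 + v p * \<delta>2"
        using D by (simp_all add: t_def s_def D_def)
      have "(t * v p - s * v q - \<delta>1) * D = 0" "(s * u q - t * u p - \<delta>2) * D = 0"
        using tD sD unfolding D_def by algebra+
      then have "t * v p - s * v q - \<delta>1 = 0" "s * u q - t * u p - \<delta>2 = 0"
        using D by (simp_all only: D_def mult_eq_0_iff simp_thms)
      then have "p + t *\<^sub>R w = q + s *\<^sub>R w'"
        by (simp add: prod_eq_iff w_def w'_def \<delta>1_def \<delta>2_def)
      then have "fst w * snd w' = snd w * fst w'"
        using characteristic_line[OF w(1), of t] characteristic_line[OF w(2), of s] characteristic_parallel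
        by simp
      with D show False
        by (simp add: w_def w'_def)
    qed
  qed auto
  then show ?thesis
    using p by (intro exI[of _ "(v p, - u p)"]) auto
next
  case False
  then show ?thesis
    by (intro exI[of _ "(1, 0)"]) auto
qed

end

section \<open>The classification of entire solutions\<close>

theorem mainTheorem13:
  fixes f :: "real \<times> real \<Rightarrow> real"
  assumes C2: "C2_entire f"
    and eq: "\<And>x y.
      2 * (x - 2 * py f (x, y)) * (y + 2 * px f (x, y)) * (py (py f) (x, y) - px (px f) (x, y))
      + (1 - 2 * py (px f) (x, y)) * (y + 2 * px f (x, y))^2
      + (x - 2 * py f (x, y))^2 * (1 + 2 * py (px f) (x, y)) = 0"
  shows "\<exists>c1 c2 :: real. (c1, c2) \<noteq> (0, 0) \<and> (\<exists>F :: real \<Rightarrow> real.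
           \<forall>p. regular_point f p \<longrightarrow>
             (\<exists>U. open U \<and> p \<in> U \<and> (\<forall>x y. (x, y) \<in> U \<longrightarrow>
                f (x, y) = (if c2 \<noteq> 0
                            then c1 * x^2 / (2 * c2) - x * y / 2 + F (c1 * x - c2 * y)
                            else x * y / 2 + F x))))"
proof -
  have Dx: "((\<lambda>t. g (t, y)) has_real_derivative px g (x, y)) (at x)"
    and Dy: "((\<lambda>t. g (x, t)) has_real_derivative py g (x, y)) (at y)" if "has_partials g" for g x y
    using that by (auto simp: has_partials_def px_def py_def DERIV_deriv_iff_real_differentiable)
  have hp: "has_partials f" "has_partials (px f)" "has_partials (py f)"
    and cf: "continuous_on UNIV (px f)" "continuous_on UNIV (py f)" "continuous_on UNIV (px (px f))"
    "continuous_on UNIV (py (px f))" "continuous_on UNIV (py (py f))"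
    using C2 by (simp_all add: C2_entire_def)
  have mixed: "((\<lambda>t. py f (t, y)) has_real_derivative py (px f) (x, y)) (at x)" for x y
    by (rule mixed_partials_eq[OF Dx Dy Dy]) (use hp cf in auto)
  interpret ruled_field "\<lambda>p. fst p - 2 * py f p" "\<lambda>p. snd p + 2 * px f p"
    "\<lambda>p. 1 - 2 * py (px f) p" "\<lambda>p. - 2 * py (py f) p" "\<lambda>p. 2 * px (px f) p" "\<lambda>p. 1 + 2 * py (px f) p"
  proof
    fix x y
    show "((\<lambda>t. fst (t, y) - 2 * py f (t, y)) has_real_derivative 1 - 2 * py (px f) (x, y)) (at x)"
      using mixed by (auto intro!: derivative_eq_intros)
    show "((\<lambda>t. fst (x, t) - 2 * py f (x, t)) has_real_derivative - 2 * py (py f) (x, y)) (at y)"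
      using Dy[OF hp(3)] by (auto intro!: derivative_eq_intros)
    show "((\<lambda>t. snd (t, y) + 2 * px f (t, y)) has_real_derivative 2 * px (px f) (x, y)) (at x)"
      using Dx[OF hp(2)] by (auto intro!: derivative_eq_intros)
    show "((\<lambda>t. snd (x, t) + 2 * px f (x, t)) has_real_derivative 1 + 2 * py (px f) (x, y)) (at y)"
      using Dy[OF hp(2)] by (auto intro!: derivative_eq_intros)
  next
    fix p :: "real \<times> real"
    show "(snd p + 2 * px f p)\<^sup>2 * (1 - 2 * py (px f) p) - (fst p - 2 * py f p) * (snd p + 2 * px f p) *
        (- 2 * py (py f) p + 2 * px (px f) p) + (fst p - 2 * py f p)\<^sup>2 * (1 + 2 * py (px f) p) = 0"
      using eq[of "fst p" "snd p"] by (simp add: algebra_simps)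
  qed (auto intro!: continuous_intros cf)
  obtain w where w: "w \<noteq> (0, 0)" "\<forall>p. fst w * (fst p - 2 * py f p) + snd w * (snd p + 2 * px f p) = 0"
    using constant_direction by blast
  \<comment> \<open>The sign turns the orthogonality relation into
    \<open>c1 * u = c2 * v\<close>.\<close>
  define c1 c2 where "c1 = fst w" and "c2 = - snd w"
  have c: "(c1, c2) \<noteq> (0, 0)"
    using w(1) by (auto simp: c1_def c2_def prod_eq_iff)
  have lin: "c1 * (x - 2 * py f (x, y)) = c2 * (y + 2 * px f (x, y))" for x y
    using spec[OF w(2), of "(x, y)"] by (simp add: c1_def c2_def)
  have "\<exists>F. \<forall>x y. f (x, y) = (if c2 \<noteq> 0 then c1 * x^2 / (2 * c2) - x * y / 2 + F (c1 * x - c2 * y)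
      else x * y / 2 + F x)"
  proof (cases "c2 = 0")
    case True
    with c lin have py: "py f (x, y) = x / 2" for x y
      by (simp add: field_simps)
    have sol: "f (x, y) = x * y / 2 + f (x, 0)" for x y
    proof -
      have "((\<lambda>t. f (x, t) - x * t / 2) has_real_derivative 0) (at t)" for t
        using Dy[OF hp(1), of x t] py by (auto intro!: derivative_eq_intros)
      from DERIV_isconst_all[OF allI[OF this], of y 0] show ?thesis
        by simp
    qed
    show ?thesis
    proof (intro exI[of _ "\<lambda>z. f (z, 0)"] allI)
      show "f (x, y) = (if c2 \<noteq> 0 then c1 * x^2 / (2 * c2) - x * y / 2 + f (c1 * x - c2 * y, 0) else x * y / 2 + f (x, 0))" for x y
        using sol[of x y] True by simp
    qed
  next
    case False
    define k where "k = c1 / c2"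
    have k: "px f (x, y) + k * py f (x, y) = (k * x - y) / 2" for x y
      using lin[of x y] False by (simp add: k_def field_simps)
    \<comment> \<open>The first-order equation for f is a transport equation with straight
      characteristics \<open>y = b + k * x\<close>. Along each of them its right side is the
      constant \<open>- b / 2\<close>, so f is affine there.\<close>
    have line: "f (x, b + k * x) = f (0, b) - b * x / 2" for x b
    proof -
      have "((\<lambda>t. f (t, b + k * t) + b * t / 2) has_real_derivative 0) (at t)" for t
      proof -
        have D: "(f has_derivative (\<lambda>h. px f (t, b + k * t) * fst h + py f (t, b + k * t) * snd h))
            (at (t, b + k * t))"
          by (rule has_derivative_of_continuous_partials[OF open_UNIV])
            (use Dx[OF hp(1)] Dy[OF hp(1)] cf in auto)
        have "((\<lambda>t. f (t, b + k * t)) has_derivative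
            (\<lambda>h. px f (t, b + k * t) * fst (h, k * h) + py f (t, b + k * t) * snd (h, k * h))) (at t)"
          by (rule has_derivative_compose[where f="\<lambda>t. (t, b + k * t)", OF _ D])
            (auto intro!: derivative_eq_intros)
        then have "((\<lambda>t. f (t, b + k * t)) has_real_derivative
            (px f (t, b + k * t) + k * py f (t, b + k * t))) (at t)"
          unfolding has_field_derivative_def by (rule has_derivative_eq_rhs) (auto simp: algebra_simps)
        then show ?thesis
          unfolding k by (auto intro!: derivative_eq_intros)
      qed
      from DERIV_isconst_all[OF allI[OF this], of x 0] show ?thesis
        by simp
    qed
    have sol: "f (x, y) = c1 * x^2 / (2 * c2) - x * y / 2 + f (0, - (c1 * x - c2 * y) / c2)" for x y
    proof -
      have "- (c1 * x - c2 * y) / c2 = y - k * x"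
        using False by (simp add: k_def field_simps)
      moreover have "f (x, y) = f (0, y - k * x) - (y - k * x) * x / 2"
        using line[of x "y - k * x"] by simp
      ultimately show ?thesis
        using False by (simp add: k_def field_simps power2_eq_square)
    qed
    show ?thesis
    \<comment> \<open>The line through (x, y) meets the y-axis at height \<open>y - k * x\<close>,
      which is \<open>- z / c2\<close> for \<open>z = c1 * x - c2 * y\<close>; F records f on that
      axis.\<close>
    proof (intro exI[of _ "\<lambda>z. f (0, - z / c2)"] allI)
      show "f (x, y) = (if c2 \<noteq> 0 then c1 * x^2 / (2 * c2) - x * y / 2 + f (0, - (c1 * x - c2 * y) / c2)
          else x * y / 2 + f (0, - x / c2))" for x y
        using sol[of x y] False by simp
    qed
  qed
  then obtain F where F: "\<And>x y. f (x, y) = (if c2 \<noteq> 0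
      then c1 * x^2 / (2 * c2) - x * y / 2 + F (c1 * x - c2 * y) else x * y / 2 + F x)"
    by blast
  show ?thesis
    \<comment> \<open>The formula holds on the whole plane with a single F, so \<open>UNIV\<close>
      is the neighbourhood of every regular point.\<close>
    by (rule exI[of _ c1], rule exI[of _ c2], rule conjI[OF c], rule exI[of _ F],
        intro allI impI exI[of _ UNIV] conjI open_UNIV UNIV_I F)
qed

end
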